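(* Let $\alpha,\beta\in C(E_1,E_2)$ with $\alpha,\beta\in\mathcal X$ and $\alpha\le\beta$ on $E_1$, where $\alpha$ is a subsolution and $\beta$ a supersolution of $u''=f(y,u,u')$. Then there exists a global solution $u$ of $u''=f(y,u,u')$ on $E_1$ satisfying $\alpha\le u\le\beta$ on $E_1$.
   Context: $E_1,E_2\subseteq\mathbb R$ are open intervals and $E_2\subseteq\tilde E_2\subseteq\overline{E_2}$. $f:E_1\times\tilde E_2\times\mathbb R\to\mathbb R$ is continuous and locally Lipschitz on $E_1\times E_2\times\mathbb R$. For $C\in(0,\infty]$ let $f_C(y,u,v)=f(y,u,(-C)\vee v\wedge C)$ (so $f_\infty=f$). Nagumo condition (assumed): for every compact $K\subset E_1\times\tilde E_2$ there is $\varphi:[0,\infty)\to\mathbb R$ with $\int_r^\infty\frac{s}{\varphi(s)}ds=\infty$ for all $r>0$ and $|f_C(y,u,v)|\le\varphi(|v|)$ for all $(y,u)\in K$, $v\in\mathbb R$, $C\in(0,\infty]$. A function $\alpha\in C(E_1,\tilde E_2)$ is a subsolution if for each $y\in E_1$ either $\alpha$ is $C^2$ near $y$ with $\alpha''(y)\ge f(y,\alpha(y),\alpha'(y))$, or $\alpha$ has finite one-sided derivatives at $y$ with $D^-\alpha(y)<D^+\alpha(y)$; $\beta\in C(E_1,\tilde E_2)$ is a supersolution if for each $y$ either $\beta$ is $C^2$ near $y$ with $\beta''(y)\le f(y,\beta(y),\beta'(y))$, or $D^-\beta(y)>D^+\beta(y)$ (finite). Here $D^-,D^+$ are left and right derivatives.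 $\mathcal X=\{\gamma\in C(E_1,\tilde E_2):\ \sup_{y\in D(\gamma)\cap K}|\gamma'(y)|<\infty$ for every compact $K\subset E_1\}$, where $D(\gamma)$ is the set where $\gamma$ is differentiable. A global solution is a $C^2$ function $u:E_1\to\tilde E_2$ satisfying $u''(y)=f(y,u(y),u'(y))$ for all $y\in E_1$. *)

theory Defs
  imports "HOL-Analysis.Analysis"
begin

(* f_C(y,u,v) = f(y,u,(-C) \<or> v \<and> C) for a real C > 0; the case C = \<infinity> is f itself *)
definition fC :: "real \<Rightarrow> (real \<Rightarrow> real \<Rightarrow> real \<Rightarrow> real) \<Rightarrow> real \<Rightarrow> real \<Rightarrow> real \<Rightarrow> real" where
  "fC C f y u v = f y u (max (- C) (min v C))"

definition loc_lipschitz_on :: "(real \<times> real \<times> real) set \<Rightarrow> (real \<Rightarrow> real \<Rightarrow> real \<Rightarrow> real) \<Rightarrow> bool" where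
  "loc_lipschitz_on S f \<longleftrightarrow>
     (\<forall>p\<in>S. \<exists>e>0. \<exists>L. \<forall>q\<in>ball p e \<inter> S. \<forall>r\<in>ball p e \<inter> S.
        \<bar>(case q of (y,u,v) \<Rightarrow> f y u v) - (case r of (y,u,v) \<Rightarrow> f y u v)\<bar> \<le> L * dist q r)"

(* Nagumo condition on E1 \<times> E2t, uniformly in C \<in> (0,\<infinity>] *)
definition nagumo :: "real set \<Rightarrow> real set \<Rightarrow> (real \<Rightarrow> real \<Rightarrow> real \<Rightarrow> real) \<Rightarrow> bool" where
  "nagumo E1 E2t f \<longleftrightarrow>
     (\<forall>K. compact K \<and> K \<subseteq> E1 \<times> E2t \<longrightarrow>
        (\<exists>\<phi> :: real \<Rightarrow> real.
           (\<forall>r>0. (\<integral>\<^sup>+ s. (ennreal s / ennreal (\<phi> s)) * indicator {r..} s \<partial>lborel) = \<infinity>) \<and>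
           (\<forall>(y,u)\<in>K. \<forall>v. \<bar>f y u v\<bar> \<le> \<phi> \<bar>v\<bar> \<and> (\<forall>C>0. \<bar>fC C f y u v\<bar> \<le> \<phi> \<bar>v\<bar>))))"

definition C2_on :: "real set \<Rightarrow> (real \<Rightarrow> real) \<Rightarrow> bool" where
  "C2_on U g \<longleftrightarrow> (\<exists>g' g''. (\<forall>x\<in>U. (g has_real_derivative g' x) (at x) \<and>
                                    (g' has_real_derivative g'' x) (at x)) \<and> continuous_on U g'')"

definition subsolution :: "real set \<Rightarrow> real set \<Rightarrow> (real \<Rightarrow> real \<Rightarrow> real \<Rightarrow> real) \<Rightarrow> (real \<Rightarrow> real) \<Rightarrow> bool" where
  "subsolution E1 E2t f \<alpha> \<longleftrightarrow> continuous_on E1 \<alpha> \<and> \<alpha> ` E1 \<subseteq> E2t \<and>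
     (\<forall>y\<in>E1.
        (\<exists>e>0. ball y e \<subseteq> E1 \<and> C2_on (ball y e) \<alpha> \<and>
               deriv (deriv \<alpha>) y \<ge> f y (\<alpha> y) (deriv \<alpha> y))
      \<or> (\<exists>dl dr. (\<alpha> has_real_derivative dl) (at_left y) \<and>
                (\<alpha> has_real_derivative dr) (at_right y) \<and> dl < dr))"

definition supersolution :: "real set \<Rightarrow> real set \<Rightarrow> (real \<Rightarrow> real \<Rightarrow> real \<Rightarrow> real) \<Rightarrow> (real \<Rightarrow> real) \<Rightarrow> bool" where
  "supersolution E1 E2t f \<beta> \<longleftrightarrow> continuous_on E1 \<beta> \<and> \<beta> ` E1 \<subseteq> E2t \<and>
     (\<forall>y\<in>E1.
        (\<exists>e>0. ball y e \<subseteq> E1 \<and> C2_on (ball y e) \<beta> \<and>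
               deriv (deriv \<beta>) y \<le> f y (\<beta> y) (deriv \<beta> y))
      \<or> (\<exists>dl dr. (\<beta> has_real_derivative dl) (at_left y) \<and>
                (\<beta> has_real_derivative dr) (at_right y) \<and> dl > dr))"

definition classX :: "real set \<Rightarrow> real set \<Rightarrow> (real \<Rightarrow> real) \<Rightarrow> bool" where
  "classX E1 E2t \<gamma> \<longleftrightarrow> continuous_on E1 \<gamma> \<and> \<gamma> ` E1 \<subseteq> E2t \<and>
     (\<forall>K. compact K \<and> K \<subseteq> E1 \<longrightarrow>
        (\<exists>B. \<forall>y\<in>K. \<gamma> differentiable (at y) \<longrightarrow> \<bar>deriv \<gamma> y\<bar> \<le> B))"

definition global_solution :: "real set \<Rightarrow> real set \<Rightarrow> (real \<Rightarrow> real \<Rightarrow> real \<Rightarrow> real) \<Rightarrow> (real \<Rightarrow> real) \<Rightarrow> bool" where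
  "global_solution E1 E2t f u \<longleftrightarrow> u ` E1 \<subseteq> E2t \<and> C2_on E1 u \<and>
     (\<forall>y\<in>E1. deriv (deriv u) y = f y (u y) (deriv u y))"

end

theory Submission
  imports Defs
begin

text \<open>On a compact interval \<open>{a..b} \<subseteq> E1\<close>, truncate \<open>f\<close> by clamping \<open>u\<close> to \<open>[\<alpha>, \<beta>]\<close> and \<open>u'\<close> to \<open>[-C, C]\<close>
  and add a bounded penalty for leaving the band. The result is bounded and globally Lipschitz, so the
  Dirichlet problem with boundary values \<open>\<alpha> a\<close>, \<open>\<alpha> b\<close> is solved by shooting. At a negative minimum of
  \<open>u - \<alpha>\<close> a kink of \<open>\<alpha>\<close> is impossible and at a smooth point \<open>u' = \<alpha>'\<close>, so the penalty gives a
  contradiction; the same holds for \<open>\<beta>\<close>. Along a solution with \<open>u'\<close> of constant sign, the antiderivative of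
  \<open>s / \<psi> s\<close> evaluated at \<open>u'\<close> varies by at most the oscillation of \<open>u\<close>; together with a mean value point this bounds
  \<open>u'\<close> independently of \<open>C\<close>, and for large \<open>C\<close> the truncation is inactive. Exhaust \<open>E1\<close> by compact intervals. The
  gradient bound gives a subsequence along which \<open>(u c, u' c)\<close> converges at one point \<open>c\<close>, and Gronwall's
  inequality upgrades this to locally uniform convergence to a global solution.\<close>

section \<open>Initial and boundary value problems with Lipschitz right-hand side\<close>

text \<open>Because the Lipschitz bound is global in \<open>x\<close>, the Picard operator acts on
  all continuous functions on \<open>{a..b}\<close>, and Banach's fixed point theorem yields a
  solution on the whole interval at once, without continuation.\<close>

lemma picard_lindelof:
  fixes H :: "real \<Rightarrow> 'a::euclidean_space \<Rightarrow> 'a"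
  assumes ab: "a \<le> b"
    and cont: "continuous_on ({a..b} \<times> UNIV) (\<lambda>(t, x). H t x)"
    and lip: "\<And>t x y. t \<in> {a..b} \<Longrightarrow> norm (H t x - H t y) \<le> L * norm (x - y)"
  obtains w where "w a = x0"
    "\<And>t. t \<in> {a..b} \<Longrightarrow> (w has_vector_derivative H t (w t)) (at t within {a..b})"
proof -
  \<comment> \<open>The contraction factor will be \<open>\<bar>L\<bar> / K\<close>; this choice
    brings it down to \<open>1/2\<close> and keeps \<open>K > 0\<close> when
    \<open>L = 0\<close>.\<close>
  define K where "K = 2 * (\<bar>L\<bar> + 1)"
  have K: "K > 0" "\<bar>L\<bar> / K \<le> 1/2" by (auto simp: K_def field_simps)
  \<comment> \<open>Clamping the time extends functions on \<open>{a..b}\<close> to bounded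
    continuous functions on the line, so that the fixed point theorem can be used on the complete
    type \<open>real \<Rightarrow>\<^sub>C 'a\<close>.\<close>
  define c where "c t = max a (min t b)" for t :: real
  have c_mem: "c t \<in> {a..b}" for t using ab by (auto simp: c_def)
  have c_id: "c t = t" if "t \<in> {a..b}" for t using that by (auto simp: c_def)
  have c_cont: "continuous_on UNIV c" unfolding c_def by (intro continuous_intros)
  define I where "I g s = H s (exp (K * (s - a)) *\<^sub>R g s)" for g :: "real \<Rightarrow> 'a" and s
  have I_cont: "continuous_on {a..b} (I g)" if g: "continuous_on {a..b} g" for g
  proof -
    have "continuous_on {a..b} (\<lambda>s. (s, exp (K * (s - a)) *\<^sub>R g s))"
      using g by (intro continuous_intros)
    then have "continuous_on {a..b} (\<lambda>s. (\<lambda>(t, x). H t x) (s, exp (K * (s - a)) *\<^sub>R g s))"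
      by (rule continuous_on_compose2[OF cont]) auto
    then show ?thesis by (simp add: I_def)
  qed
  \<comment> \<open>Conjugating the Picard operator with the weight \<open>exp (K * (t - a))\<close> makes it a contraction on all of \<open>{a..b}\<close>.\<close>
  define S where "S g t = exp (- K * (t - a)) *\<^sub>R (x0 + integral {a..t} (I g))"
    for g :: "real \<Rightarrow> 'a" and t
  have S_cont: "continuous_on {a..b} (S g)" if g: "continuous_on {a..b} g" for g
    unfolding S_def
    by (intro continuous_intros indefinite_integral_continuous_1 integrable_continuous_real I_cont g)
  have S_bc: "(\<lambda>t. S g (c t)) \<in> bcontfun" if g: "continuous_on {a..b} g" for g
  proof -
    have "continuous_on UNIV (\<lambda>t. S g (c t))"
      by (rule continuous_on_compose2[OF S_cont[OF g] c_cont]) (use c_mem in auto)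
    moreover have "bounded (S g ` {a..b})"
      by (intro compact_imp_bounded compact_continuous_image S_cont g) auto
    then have "bounded (range (\<lambda>t. S g (c t)))"
      by (rule bounded_subset) (use c_mem in auto)
    ultimately show ?thesis by (simp add: bcontfun_def)
  qed
  define T where "T g = Bcontfun (\<lambda>t. S (apply_bcontfun g) (c t))" for g :: "real \<Rightarrow>\<^sub>C 'a"
  have gc: "continuous_on A (apply_bcontfun g)" for g :: "real \<Rightarrow>\<^sub>C 'a" and A
    by (rule continuous_on_subset[of UNIV]) auto
  have T: "apply_bcontfun (T g) t = S g (c t)" for g t
    unfolding T_def using Bcontfun_inverse[OF S_bc[OF gc, of g]] by simp
  have contr: "dist (T g) (T h) \<le> 1/2 * dist g h" for g h
  proof (rule dist_bound)
    fix t0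
    define t where "t = c t0"
    have t: "t \<in> {a..b}" unfolding t_def by (rule c_mem)
    have int: "I g integrable_on {a..t}" for g :: "real \<Rightarrow>\<^sub>C 'a"
      by (rule integrable_continuous_real, rule continuous_on_subset[OF I_cont[OF gc]]) (use t in auto)
    \<comment> \<open>The weight reproduces itself under integration up to the factor
      \<open>1 / K\<close>; this is the source of the contraction.\<close>
    let ?F = "\<lambda>s. \<bar>L\<bar> * (exp (K * (s - a)) * dist g h)"
    have hi: "(?F has_integral (\<bar>L\<bar> / K * exp (K * (t - a)) * dist g h - \<bar>L\<bar> / K * exp (K * (a - a)) * dist g h)) {a..t}"
    proof (rule fundamental_theorem_of_calculus)
      fix x assume "x \<in> {a..t}"
      show "((\<lambda>s. \<bar>L\<bar> / K * exp (K * (s - a)) * dist g h) has_vector_derivative ?F x) (at x within {a..t})"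
        unfolding has_real_derivative_iff_has_vector_derivative[symmetric]
        using K by (auto intro!: derivative_eq_intros)
    qed (use t in auto)
    have "norm (integral {a..t} (I g) - integral {a..t} (I h)) = norm (integral {a..t} (\<lambda>s. I g s - I h s))"
      by (subst integral_diff) (use int in auto)
    also have "\<dots> \<le> integral {a..t} ?F"
    proof (rule integral_norm_bound_integral)
      show "(\<lambda>s. I g s - I h s) integrable_on {a..t}" using int by (intro integrable_diff)
      show "?F integrable_on {a..t}" using hi by blast
      fix s assume s: "s \<in> {a..t}"
      have "norm (I g s - I h s) \<le> L * norm (exp (K * (s - a)) *\<^sub>R g s - exp (K * (s - a)) *\<^sub>R h s)"
        unfolding I_def using s t by (intro lip) auto
      also have "\<dots> = L * (exp (K * (s - a)) * dist (g s) (h s))"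
        by (simp add: dist_norm flip: scaleR_diff_right)
      also have "\<dots> \<le> ?F s"
        using dist_bounded[of g s h] by (intro mult_mono mult_left_mono) auto
      finally show "norm (I g s - I h s) \<le> ?F s" .
    qed
    also have "\<dots> \<le> \<bar>L\<bar> / K * exp (K * (t - a)) * dist g h"
      using integral_unique[OF hi] K by (simp add: zero_le_mult_iff)
    also have "\<dots> \<le> 1/2 * exp (K * (t - a)) * dist g h"
      using K by (intro mult_right_mono) auto
    finally have *: "norm (integral {a..t} (I g) - integral {a..t} (I h)) \<le> 1/2 * exp (K * (t - a)) * dist g h" .
    have "dist (T g t0) (T h t0) = exp (- K * (t - a)) * norm (integral {a..t} (I g) - integral {a..t} (I h))"
      unfolding T by (simp add: S_def dist_norm t_def flip: scaleR_diff_right)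
    also have "\<dots> \<le> exp (- K * (t - a)) * (1/2 * exp (K * (t - a)) * dist g h)"
      by (rule mult_left_mono[OF *]) simp
    also have "\<dots> = 1/2 * dist g h" by (simp add: mult_ac flip: exp_add)
    finally show "dist (T g t0) (T h t0) \<le> 1/2 * dist g h" .
  qed
  obtain g where g: "T g = g"
    using banach_fix_type[of "1/2" T] contr by auto
  define w where "w t = exp (K * (t - a)) *\<^sub>R apply_bcontfun g t" for t
  have w: "w t = x0 + integral {a..t} (I g)" if "t \<in> {a..b}" for t
  proof -
    have "apply_bcontfun g t = S g t" using T[of g t] g c_id[OF that] by simp
    then show ?thesis by (simp add: w_def S_def mult_ac flip: exp_add)
  qed
  show ?thesis
  proof
    show "w a = x0" using w[of a] ab by simp
    fix t assume t: "t \<in> {a..b}"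
    have "((\<lambda>t. x0 + integral {a..t} (I g)) has_vector_derivative I g t) (at t within {a..b})"
      using integral_has_vector_derivative[OF I_cont[OF gc] t, of g] by (auto intro!: derivative_eq_intros)
    then have "(w has_vector_derivative I g t) (at t within {a..b})"
      by (rule has_vector_derivative_transform[OF t, rotated]) (use w in auto)
    then show "(w has_vector_derivative H t (w t)) (at t within {a..b})"
      by (simp add: I_def w_def)
  qed
qed

section \<open>Gronwall estimates, second-order systems and shooting\<close>

text \<open>\<open>E t * exp (- K * t)\<close> is nonincreasing and \<open>E t * exp (K * t)\<close>
  is nondecreasing. Both directions are needed because solutions are later compared with their data
  at a point that need not be an endpoint.\<close>

lemma gronwall_two_sided:
  fixes E :: "real \<Rightarrow> real"
  assumes der: "\<And>t. t \<in> {a..b} \<Longrightarrow> (E has_real_derivative E' t) (at t within {a..b})"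
    and bd: "\<And>t. t \<in> {a..b} \<Longrightarrow> \<bar>E' t\<bar> \<le> K * E t"
    and st: "s \<in> {a..b}" "t \<in> {a..b}"
  shows "E t \<le> E s * exp (K * \<bar>t - s\<bar>)"
proof -
  have cont: "continuous_on {a..b} E"
    unfolding continuous_on_eq_continuous_within using der DERIV_continuous by blast
  have at: "(E has_real_derivative E' x) (at x)" if "a < x" "x < b" for x
    using der[of x] that by (simp add: at_within_Icc_at)
  show ?thesis
  proof (cases "s \<le> t")
    case True
    have "E t * exp (- K * t) \<le> E s * exp (- K * s)"
    proof (rule DERIV_nonpos_imp_decreasing_open[OF True])
      fix x assume x: "s < x" "x < t"
      then have "((\<lambda>x. E x * exp (- K * x)) has_real_derivative (E' x - K * E x) * exp (- K * x)) (at x)"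
        using st by (auto intro!: derivative_eq_intros at simp: algebra_simps)
      moreover have "(E' x - K * E x) * exp (- K * x) \<le> 0"
        using bd[of x] x st by (intro mult_nonpos_nonneg) auto
      ultimately show "\<exists>y. ((\<lambda>x. E x * exp (- K * x)) has_real_derivative y) (at x) \<and> y \<le> 0" by blast
    next
      show "continuous_on {s..t} (\<lambda>x. E x * exp (- K * x))"
        using st by (intro continuous_intros continuous_on_subset[OF cont]) auto
    qed
    then have "E t * exp (- K * t) * exp (K * t) \<le> E s * exp (- K * s) * exp (K * t)"
      by (rule mult_right_mono) simp
    then show ?thesis using True by (simp add: mult.assoc algebra_simps flip: exp_add)
  next
    case False
    then have ts: "t \<le> s" by simp
    have "E t * exp (K * t) \<le> E s * exp (K * s)"
    proof (rule DERIV_nonneg_imp_increasing_open[OF ts])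
      fix x assume x: "t < x" "x < s"
      then have "((\<lambda>x. E x * exp (K * x)) has_real_derivative (E' x + K * E x) * exp (K * x)) (at x)"
        using st by (auto intro!: derivative_eq_intros at simp: algebra_simps)
      moreover have "(E' x + K * E x) * exp (K * x) \<ge> 0"
        using bd[of x] x st by (intro mult_nonneg_nonneg) auto
      ultimately show "\<exists>y. ((\<lambda>x. E x * exp (K * x)) has_real_derivative y) (at x) \<and> y \<ge> 0" by blast
    next
      show "continuous_on {t..s} (\<lambda>x. E x * exp (K * x))"
        using st by (intro continuous_intros continuous_on_subset[OF cont]) auto
    qed
    then have "E t * exp (K * t) * exp (- K * t) \<le> E s * exp (K * s) * exp (- K * t)"
      by (rule mult_right_mono) simp
    then show ?thesis using ts by (simp add: mult.assoc algebra_simps flip: exp_add)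
  qed
qed

text \<open>The second-order equation as a first-order system, with the slope \<open>v\<close> kept
  as a function of its own. Derivatives are taken within \<open>{a..b}\<close>, hence are one-sided
  at the endpoints.\<close>

definition solves_on :: "(real \<Rightarrow> real \<Rightarrow> real \<Rightarrow> real) \<Rightarrow> real \<Rightarrow> real \<Rightarrow> (real \<Rightarrow> real) \<Rightarrow> (real \<Rightarrow> real) \<Rightarrow> bool" where
  "solves_on G a b u v \<longleftrightarrow>
     (\<forall>t\<in>{a..b}. (u has_real_derivative v t) (at t within {a..b}) \<and>
                 (v has_real_derivative G t (u t) (v t)) (at t within {a..b}))"

lemma solves_onD:
  assumes "solves_on G a b u v" "t \<in> {a..b}"
  shows "(u has_real_derivative v t) (at t within {a..b})"
    "(v has_real_derivative G t (u t) (v t)) (at t within {a..b})"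
  using assms by (auto simp: solves_on_def)

lemma solves_onD_at:
  assumes "solves_on G a b u v" "a < t" "t < b"
  shows "(u has_real_derivative v t) (at t)" "(v has_real_derivative G t (u t) (v t)) (at t)"
  using solves_onD[OF assms(1), of t] assms(2,3) by (auto simp: at_within_Icc_at)

lemma solves_on_continuous:
  assumes "solves_on G a b u v"
  shows "continuous_on {a..b} u" "continuous_on {a..b} v"
  unfolding continuous_on_eq_continuous_within
  using solves_onD[OF assms] DERIV_continuous by blast+

lemma solves_on_subset:
  assumes "solves_on G a b u v" "a \<le> c" "d \<le> b"
  shows "solves_on G c d u v"
  unfolding solves_on_def
proof (intro ballI conjI)
  fix t assume t: "t \<in> {c..d}"
  have "{c..d} \<subseteq> {a..b}" "t \<in> {a..b}" using assms t by auto
  then show "(u has_real_derivative v t) (at t within {c..d})"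
    "(v has_real_derivative G t (u t) (v t)) (at t within {c..d})"
    using solves_onD[OF assms(1)] has_field_derivative_subset by blast+
qed

text \<open>Only agreement along the trajectory is required. This is how a truncated right-hand side
  is exchanged for \<open>f\<close> once the truncation is known to be inactive.\<close>

lemma solves_on_cong:
  assumes "solves_on G a b u v" "\<And>t. t \<in> {a..b} \<Longrightarrow> G t (u t) (v t) = G' t (u t) (v t)"
  shows "solves_on G' a b u v"
  using assms by (auto simp: solves_on_def)

text \<open>Gronwall's inequality for the squared distance of the two states: \<open>2 *
  (\<bar>p\<bar> * \<bar>q\<bar>) \<le> p\<^sup>2 + q\<^sup>2\<close> bounds its derivative by
  \<open>1 + 3 * L\<close> times itself. The Lipschitz estimate is asked for only along the two
  trajectories, so a right-hand side that is Lipschitz merely on a box is covered.\<close>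

lemma solves_on_stability:
  assumes s1: "solves_on G a b u1 v1" and s2: "solves_on G a b u2 v2"
    and L: "0 \<le> L"
    and lip: "\<And>t. t \<in> {a..b} \<Longrightarrow>
      \<bar>G t (u1 t) (v1 t) - G t (u2 t) (v2 t)\<bar> \<le> L * (\<bar>u1 t - u2 t\<bar> + \<bar>v1 t - v2 t\<bar>)"
    and st: "s \<in> {a..b}" "t \<in> {a..b}"
  shows "(u1 t - u2 t)\<^sup>2 + (v1 t - v2 t)\<^sup>2 \<le>
         ((u1 s - u2 s)\<^sup>2 + (v1 s - v2 s)\<^sup>2) * exp ((1 + 3 * L) * \<bar>t - s\<bar>)"
proof (rule gronwall_two_sided[where a = a and b = b and E = "\<lambda>t. (u1 t - u2 t)\<^sup>2 + (v1 t - v2 t)\<^sup>2"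
    and E' = "\<lambda>t. 2 * (u1 t - u2 t) * (v1 t - v2 t)
      + 2 * (v1 t - v2 t) * (G t (u1 t) (v1 t) - G t (u2 t) (v2 t))"])
  fix t assume t: "t \<in> {a..b}"
  show "((\<lambda>t. (u1 t - u2 t)\<^sup>2 + (v1 t - v2 t)\<^sup>2) has_real_derivative
      2 * (u1 t - u2 t) * (v1 t - v2 t)
      + 2 * (v1 t - v2 t) * (G t (u1 t) (v1 t) - G t (u2 t) (v2 t))) (at t within {a..b})"
    by (auto intro!: derivative_eq_intros solves_onD[OF s1 t] solves_onD[OF s2 t] simp: algebra_simps)
  define p q w where "p = u1 t - u2 t" and "q = v1 t - v2 t"
    and "w = G t (u1 t) (v1 t) - G t (u2 t) (v2 t)"
  have w: "\<bar>w\<bar> \<le> L * (\<bar>p\<bar> + \<bar>q\<bar>)" using lip[OF t] by (simp add: p_def q_def w_def)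
  have pq: "2 * (\<bar>p\<bar> * \<bar>q\<bar>) \<le> p\<^sup>2 + q\<^sup>2"
    using sum_squares_bound[of "\<bar>p\<bar>" "\<bar>q\<bar>"] by simp
  have "\<bar>2 * p * q + 2 * q * w\<bar> \<le> 2 * (\<bar>p\<bar> * \<bar>q\<bar>) + 2 * (\<bar>q\<bar> * \<bar>w\<bar>)"
    by (rule order_trans[OF abs_triangle_ineq]) (simp add: abs_mult)
  also have "\<dots> \<le> 2 * (\<bar>p\<bar> * \<bar>q\<bar>) + 2 * (\<bar>q\<bar> * (L * (\<bar>p\<bar> + \<bar>q\<bar>)))"
    using w by (intro add_mono mult_left_mono) auto
  also have "\<dots> = 2 * (\<bar>p\<bar> * \<bar>q\<bar>) + L * (2 * (\<bar>p\<bar> * \<bar>q\<bar>)) + 2 * L * q\<^sup>2"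
    by (simp add: algebra_simps power2_eq_square)
  also have "\<dots> \<le> (p\<^sup>2 + q\<^sup>2) + L * (p\<^sup>2 + q\<^sup>2) + 2 * L * (p\<^sup>2 + q\<^sup>2)"
    using L pq by (intro add_mono mult_left_mono) auto
  also have "\<dots> = (1 + 3 * L) * (p\<^sup>2 + q\<^sup>2)" by (simp add: algebra_simps)
  finally show "\<bar>2 * (u1 t - u2 t) * (v1 t - v2 t)
      + 2 * (v1 t - v2 t) * (G t (u1 t) (v1 t) - G t (u2 t) (v2 t))\<bar>
      \<le> (1 + 3 * L) * ((u1 t - u2 t)\<^sup>2 + (v1 t - v2 t)\<^sup>2)"
    unfolding p_def q_def w_def .
qed (use st in auto)

text \<open>The pair \<open>(u, v)\<close> solves a first-order system in the plane with Lipschitz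
  constant \<open>1 + 2 * L\<close> in the product norm.\<close>

lemma second_order_ivp:
  fixes G :: "real \<Rightarrow> real \<Rightarrow> real \<Rightarrow> real"
  assumes ab: "a \<le> b"
    and cont: "continuous_on ({a..b} \<times> UNIV \<times> UNIV) (\<lambda>(t, u, v). G t u v)"
    and L: "0 \<le> L"
    and lip: "\<And>t u v u' v'. t \<in> {a..b} \<Longrightarrow> \<bar>G t u v - G t u' v'\<bar> \<le> L * (\<bar>u - u'\<bar> + \<bar>v - v'\<bar>)"
  obtains u v where "solves_on G a b u v" "u a = A" "v a = s"
proof -
  define H where "H t x = (snd x, G t (fst x) (snd x))" for t x
  have H_cont: "continuous_on ({a..b} \<times> UNIV) (\<lambda>(t, x). H t x)"
  proof -
    have "continuous_on ({a..b} \<times> UNIV) (\<lambda>(t, x). (\<lambda>(t, u, v). G t u v) (t, fst x, snd x))"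
      unfolding split_beta by (rule continuous_on_compose2[OF cont, unfolded split_beta]) (auto intro!: continuous_intros)
    then show ?thesis unfolding H_def split_beta by (auto intro!: continuous_intros)
  qed
  have H_lip: "norm (H t x - H t y) \<le> (1 + 2 * L) * norm (x - y)" if t: "t \<in> {a..b}" for t x y
  proof -
    have f: "\<bar>fst x - fst y\<bar> \<le> norm (x - y)" and s: "\<bar>snd x - snd y\<bar> \<le> norm (x - y)"
      using norm_fst_le[of "fst (x - y)" "snd (x - y)"] norm_snd_le[of "snd (x - y)" "fst (x - y)"]
      unfolding prod.collapse by auto
    have "norm (H t x - H t y) \<le> \<bar>snd x - snd y\<bar> + \<bar>G t (fst x) (snd x) - G t (fst y) (snd y)\<bar>"
      using norm_Pair_le[of "snd x - snd y" "G t (fst x) (snd x) - G t (fst y) (snd y)"] by (simp add: H_def)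
    also have "\<dots> \<le> norm (x - y) + L * (norm (x - y) + norm (x - y))"
      by (rule add_mono[OF s order_trans[OF lip[OF t]]]) (intro mult_left_mono add_mono f s L)
    finally show ?thesis by (simp add: algebra_simps)
  qed
  obtain w where w: "w a = (A, s)" "\<And>t. t \<in> {a..b} \<Longrightarrow> (w has_vector_derivative H t (w t)) (at t within {a..b})"
    using picard_lindelof[OF ab H_cont H_lip, of "(A, s)"] by metis
  show ?thesis
  proof
    show "fst (w a) = A" "snd (w a) = s" using w(1) by auto
    show "solves_on G a b (\<lambda>t. fst (w t)) (\<lambda>t. snd (w t))"
      unfolding solves_on_def
    proof (intro ballI conjI)
      fix t assume t: "t \<in> {a..b}"
      show "((\<lambda>t. fst (w t)) has_real_derivative snd (w t)) (at t within {a..b})"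
        using bounded_linear.has_vector_derivative[OF bounded_linear_fst w(2)[OF t]]
        by (simp add: H_def has_real_derivative_iff_has_vector_derivative)
      show "((\<lambda>t. snd (w t)) has_real_derivative G t (fst (w t)) (snd (w t))) (at t within {a..b})"
        using bounded_linear.has_vector_derivative[OF bounded_linear_snd w(2)[OF t]]
        by (simp add: H_def has_real_derivative_iff_has_vector_derivative)
    qed
  qed
qed

text \<open>The mean value inequality is used twice: first \<open>v\<close> stays within
  \<open>B * (b - a)\<close> of \<open>v a\<close>, then this bounds the derivative of
  \<open>u t - v a * t\<close>.\<close>

lemma solves_on_linear_growth:
  assumes sol: "solves_on G a b u v" and ab: "a \<le> b"
    and bd: "\<And>t. t \<in> {a..b} \<Longrightarrow> \<bar>G t (u t) (v t)\<bar> \<le> B"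
  shows "\<bar>u b - u a - v a * (b - a)\<bar> \<le> B * (b - a) * (b - a)"
proof -
  have v: "\<bar>v t - v a\<bar> \<le> B * (b - a)" if t: "t \<in> {a..b}" for t
  proof -
    have "norm (v t - v a) \<le> B * norm (t - a)"
      by (rule field_differentiable_bound[where S = "{a..b}" and f' = "\<lambda>t. G t (u t) (v t)"])
         (use t ab bd solves_onD[OF sol] in auto)
    moreover have "B \<ge> 0" using bd[OF t] by simp
    then have "B * norm (t - a) \<le> B * (b - a)" using t by (intro mult_left_mono) auto
    ultimately show ?thesis by simp
  qed
  have "norm ((u b - v a * b) - (u a - v a * a)) \<le> (B * (b - a)) * norm (b - a)"
    by (rule field_differentiable_bound[where S = "{a..b}" and f = "\<lambda>t. u t - v a * t" and f' = "\<lambda>t. v t - v a"])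
       (use ab v in \<open>auto intro!: derivative_eq_intros solves_onD[OF sol]\<close>)
  then show ?thesis using ab by (simp add: algebra_simps)
qed

text \<open>Shooting: \<open>u b\<close> depends continuously on the initial slope \<open>v a\<close> and, \<open>G\<close> being bounded,
  differs from the linear function \<open>u a + v a * (b - a)\<close> by a bounded amount.\<close>
lemma dirichlet_problem_bounded_lipschitz:
  fixes G :: "real \<Rightarrow> real \<Rightarrow> real \<Rightarrow> real"
  assumes ab: "a < b"
    and cont: "continuous_on ({a..b} \<times> UNIV \<times> UNIV) (\<lambda>(t, u, v). G t u v)"
    and L: "0 \<le> L"
    and lip: "\<And>t u v u' v'. t \<in> {a..b} \<Longrightarrow> \<bar>G t u v - G t u' v'\<bar> \<le> L * (\<bar>u - u'\<bar> + \<bar>v - v'\<bar>)"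
    and bd: "\<And>t u v. t \<in> {a..b} \<Longrightarrow> \<bar>G t u v\<bar> \<le> B"
  obtains u v where "solves_on G a b u v" "u a = A" "u b = A'"
proof -
  have "\<exists>u v. solves_on G a b u v \<and> u a = A \<and> v a = s" for s
    using second_order_ivp[OF less_imp_le[OF ab] cont L lip, of A s] by blast
  then obtain u v where sol: "\<And>s. solves_on G a b (u s) (v s)" and ua: "\<And>s. u s a = A" and va: "\<And>s. v s a = s"
    by metis
  \<comment> \<open>The square root of the Gronwall factor, since the stability estimate is for
    squares.\<close>
  define M where "M = exp ((1 + 3 * L) * (b - a) / 2)"
  have "\<bar>u s b - u s' b\<bar> \<le> M * \<bar>s - s'\<bar>" for s s'
  proof -
    have "(u s b - u s' b)\<^sup>2 \<le> (u s b - u s' b)\<^sup>2 + (v s b - v s' b)\<^sup>2" by simp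
    also have "\<dots> \<le> ((u s a - u s' a)\<^sup>2 + (v s a - v s' a)\<^sup>2) * exp ((1 + 3 * L) * \<bar>b - a\<bar>)"
      by (rule solves_on_stability[OF sol sol L lip]) (use ab in auto)
    also have "\<dots> = (M * \<bar>s - s'\<bar>)\<^sup>2"
      using ab by (simp add: ua va M_def power_mult_distrib flip: exp_double)
    finally have "\<bar>u s b - u s' b\<bar> \<le> \<bar>M * \<bar>s - s'\<bar>\<bar>" by (simp only: abs_le_square_iff)
    then show ?thesis by (simp add: abs_mult M_def)
  qed
  then have "M-lipschitz_on UNIV (\<lambda>s. u s b)"
    by (intro lipschitz_onI) (auto simp: dist_real_def M_def)
  then have cont_s: "continuous_on UNIV (\<lambda>s. u s b)" by (rule lipschitz_on_continuous_on)
  have gr: "\<bar>u s b - A - s * (b - a)\<bar> \<le> B * (b - a) * (b - a)" for s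
    using solves_on_linear_growth[OF sol[of s], of B] bd ab ua va by simp
  \<comment> \<open>The slope of the chord, shifted by \<open>B * (b - a)\<close>: the growth
    estimate then puts \<open>u s1 b\<close> at or below and \<open>u s2 b\<close> at or above the
    target \<open>A'\<close>.\<close>
  define s1 s2 where "s1 = (A' - A) / (b - a) - B * (b - a)" and "s2 = (A' - A) / (b - a) + B * (b - a)"
  have "B \<ge> 0" using bd[of a 0 0] ab by auto
  then have "s1 \<le> s2" using ab unfolding s1_def s2_def by (smt (verit) mult_nonneg_nonneg)
  have e: "s1 * (b - a) = A' - A - B * (b - a) * (b - a)" "s2 * (b - a) = A' - A + B * (b - a) * (b - a)"
    using ab by (auto simp: s1_def s2_def left_diff_distrib[of _ "B * (b - a)"] distrib_right)
  have "u s1 b \<le> A'" "A' \<le> u s2 b" using gr[of s1] gr[of s2] e by (auto simp: abs_le_iff)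
  then obtain s where "u s b = A'"
    using IVT'[of "\<lambda>s. u s b" s1 A' s2] \<open>s1 \<le> s2\<close> continuous_on_subset[OF cont_s] by auto
  then show ?thesis using that[OF sol ua] by blast
qed

section \<open>Comparison with subsolutions and the Nagumo condition\<close>

text \<open>The argument looks at a minimum of \<open>u - \<alpha>\<close>. The hypothesis
  \<open>alt\<close> is restricted to what can be used at a negative one: it speaks only of points
  with \<open>u t < \<alpha> t\<close>, and asks for a strict second-order inequality only where the
  slopes agree. In this form it also applies to \<open>- \<beta>\<close> and
  \<open>- u\<close>.\<close>

lemma sub_comparison:
  fixes \<alpha> u v w :: "real \<Rightarrow> real"
  assumes ab: "a \<le> b"
    and cont: "continuous_on {a..b} \<alpha>" "continuous_on {a..b} u"
    and bc: "\<alpha> a \<le> u a" "\<alpha> b \<le> u b"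
    and u: "\<And>t. a < t \<Longrightarrow> t < b \<Longrightarrow> (u has_real_derivative v t) (at t)"
    and v: "\<And>t. a < t \<Longrightarrow> t < b \<Longrightarrow> (v has_real_derivative w t) (at t)"
    and alt: "\<And>t. a < t \<Longrightarrow> t < b \<Longrightarrow> u t < \<alpha> t \<Longrightarrow>
      (\<exists>e>0. \<exists>\<alpha>' d. (\<forall>x\<in>ball t e. (\<alpha> has_real_derivative \<alpha>' x) (at x)) \<and>
        (\<alpha>' has_real_derivative d) (at t) \<and> (\<alpha>' t = v t \<longrightarrow> w t < d)) \<or>
      (\<exists>dl dr. (\<alpha> has_real_derivative dl) (at_left t) \<and> (\<alpha> has_real_derivative dr) (at_right t) \<and> dl < dr)"
    and t: "t \<in> {a..b}"
  shows "\<alpha> t \<le> u t"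
proof -
  define h where "h t = u t - \<alpha> t" for t
  have "continuous_on {a..b} h" unfolding h_def by (intro continuous_intros cont)
  then obtain s where s: "s \<in> {a..b}" and min: "\<And>x. x \<in> {a..b} \<Longrightarrow> h s \<le> h x"
    using continuous_attains_inf[of "{a..b}" h] t by auto
  have "h s \<ge> 0"
  proof (rule ccontr)
    assume neg: "\<not> h s \<ge> 0"
    then have "s \<noteq> a" "s \<noteq> b" using bc by (auto simp: h_def)
    with s have s': "a < s" "s < b" by auto
    define r where "r = min (s - a) (b - s)"
    have r: "r > 0" using s' by (simp add: r_def)
    have minr: "h s \<le> h (s + k)" if "\<bar>k\<bar> < r" for k
      using that by (intro min) (auto simp: r_def)
    from neg have "u s < \<alpha> s" by (simp add: h_def)
    from alt[OF s' this] show False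
    proof (elim disjE exE conjE)
      fix e \<alpha>' d
      assume e: "0 < e" and \<alpha>': "\<forall>x\<in>ball s e. (\<alpha> has_real_derivative \<alpha>' x) (at x)"
        and \<alpha>'': "(\<alpha>' has_real_derivative d) (at s)" and d: "\<alpha>' s = v s \<longrightarrow> w s < d"
      have h': "(h has_real_derivative v x - \<alpha>' x) (at x)" if "\<bar>x - s\<bar> < min e r" for x
        unfolding h_def using that
        by (intro derivative_intros u \<alpha>'[rule_format]) (auto simp: r_def dist_real_def)
      have "v s - \<alpha>' s = 0"
      proof (rule DERIV_local_min[OF h' r])
        show "\<bar>s - s\<bar> < min e r" using e r by simp
        show "\<forall>y. \<bar>s - y\<bar> < r \<longrightarrow> h s \<le> h y"
        proof (intro allI impI)
          fix y assume "\<bar>s - y\<bar> < r"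
          then show "h s \<le> h y" using minr[of "y - s"] by (simp add: abs_minus_commute)
        qed
      qed
      moreover have "((\<lambda>x. v x - \<alpha>' x) has_real_derivative w s - d) (at s)"
        by (intro derivative_intros v s' \<alpha>'')
      \<comment> \<open>The derivative of \<open>h\<close> vanishes at \<open>s\<close> and is
        itself strictly decreasing through \<open>s\<close>, so \<open>h\<close> falls immediately
        to the right of its minimum.\<close>
      ultimately obtain \<delta> where \<delta>: "\<delta> > 0" "\<And>k. 0 < k \<Longrightarrow> k < \<delta> \<Longrightarrow> v (s + k) - \<alpha>' (s + k) < 0"
        using DERIV_neg_dec_right[of "\<lambda>x. v x - \<alpha>' x" "w s - d" s] d by fastforce
      define k where "k = min (min e r) \<delta> / 2"
      have k: "k > 0" "k < min e r" "k < \<delta>" using e r \<delta>(1) by (auto simp: k_def)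
      have "h (s + k) < h s"
      proof (rule DERIV_neg_imp_decreasing_open[of s "s + k" h])
        fix x assume x: "s < x" "x < s + k"
        then show "\<exists>y. (h has_real_derivative y) (at x) \<and> y < 0"
          using h'[of x] \<delta>(2)[of "x - s"] k by (intro exI[of _ "v x - \<alpha>' x"]) auto
      next
        show "continuous_on {s..s + k} h"
          by (intro continuous_at_imp_continuous_on ballI DERIV_isCont[OF h']) (use k in auto)
      qed (use k in auto)
      with minr[of k] k show False by simp
    next
      fix dl dr
      assume dl: "(\<alpha> has_real_derivative dl) (at_left s)" and dr: "(\<alpha> has_real_derivative dr) (at_right s)"
        and lt: "dl < dr"
      have hl: "(h has_real_derivative v s - dl) (at_left s)" and hr: "(h has_real_derivative v s - dr) (at_right s)"
        using DERIV_diff[OF has_field_derivative_at_within[OF u[OF s']] dl]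
          DERIV_diff[OF has_field_derivative_at_within[OF u[OF s']] dr]
        by (simp_all add: h_def[abs_def])
      \<comment> \<open>The left slope \<open>v s - dl\<close> of \<open>h\<close> exceeds the right
        slope \<open>v s - dr\<close>, so at least one of them has the sign that a minimum
        forbids.\<close>
      consider "v s - dr < 0" | "v s - dl > 0" using lt by linarith
      then show False
      proof cases
        case 1
        from has_real_derivative_neg_dec_right[OF hr 1] obtain \<delta> where
          \<delta>: "\<delta> > 0" "\<And>k. 0 < k \<Longrightarrow> k < \<delta> \<Longrightarrow> h (s + k) < h s" by auto
        show False using \<delta>(2)[of "min r \<delta> / 2"] minr[of "min r \<delta> / 2"] r \<delta>(1) by fastforce
      next
        case 2
        from has_real_derivative_pos_inc_left[OF hl 2] obtain \<delta> where
          \<delta>: "\<delta> > 0" "\<And>k. 0 < k \<Longrightarrow> k < \<delta> \<Longrightarrow> h (s - k) < h s" by auto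
        show False using \<delta>(2)[of "min r \<delta> / 2"] minr[of "- (min r \<delta> / 2)"] r \<delta>(1) by fastforce
      qed
    qed
  qed
  then show ?thesis using min[OF t] by (simp add: h_def)
qed

section \<open>Monotone envelopes of the nonlinearity and the Nagumo integral\<close>

text \<open>On the compact set \<open>X \<times> cball s 1\<close> continuity is uniform, so one
  \<open>d\<close> serves every \<open>x\<close> and the estimate passes to the suprema.\<close>

lemma continuous_on_SUP_compact:
  fixes g :: "'a::metric_space \<times> real \<Rightarrow> real"
  assumes X: "compact X" "X \<noteq> {}" and g: "continuous_on (X \<times> UNIV) g"
  shows "continuous_on UNIV (\<lambda>s. SUP x\<in>X. g (x, s))"
  unfolding continuous_on_iff
proof (intro ballI allI impI)
  fix s e :: real assume e: "e > 0"
  have bdd: "bdd_above ((\<lambda>x. g (x, s)) ` X)" for s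
    by (intro bounded_imp_bdd_above compact_imp_bounded compact_continuous_image X
        continuous_on_compose2[OF g]) (auto intro!: continuous_intros)
  have "compact (X \<times> cball s 1)" using X by (intro compact_Times) auto
  then have "uniformly_continuous_on (X \<times> cball s 1) g"
    by (intro compact_uniformly_continuous continuous_on_subset[OF g]) auto
  then obtain d where d: "d > 0"
    "\<And>p q. p \<in> X \<times> cball s 1 \<Longrightarrow> q \<in> X \<times> cball s 1 \<Longrightarrow> dist q p < d \<Longrightarrow> dist (g q) (g p) < e / 2"
    unfolding uniformly_continuous_on_def by (meson e half_gt_zero)
  show "\<exists>d>0. \<forall>s'\<in>UNIV. dist s' s < d \<longrightarrow> dist (SUP x\<in>X. g (x, s')) (SUP x\<in>X. g (x, s)) < e"
  proof (intro exI[of _ "min d 1"] conjI ballI impI)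
    show "min d 1 > 0" using d by simp
    fix s' assume s': "dist s' s < min d 1"
    have *: "\<bar>g (x, s') - g (x, s)\<bar> < e / 2" if "x \<in> X" for x
      using d(2)[of "(x, s)" "(x, s')"] s' that by (simp add: dist_Pair_Pair dist_commute dist_real_def[of "g _"])
    have "(SUP x\<in>X. g (x, s')) \<le> (SUP x\<in>X. g (x, s)) + e / 2"
    proof (rule cSUP_least[OF X(2)])
      fix x assume x: "x \<in> X"
      show "g (x, s') \<le> (SUP x\<in>X. g (x, s)) + e / 2"
        using *[OF x] cSUP_upper[OF x bdd, of s] by linarith
    qed
    moreover have "(SUP x\<in>X. g (x, s)) \<le> (SUP x\<in>X. g (x, s')) + e / 2"
    proof (rule cSUP_least[OF X(2)])
      fix x assume x: "x \<in> X"
      show "g (x, s) \<le> (SUP x\<in>X. g (x, s')) + e / 2"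
        using *[OF x] cSUP_upper[OF x bdd, of s'] by linarith
    qed
    ultimately show "dist (SUP x\<in>X. g (x, s')) (SUP x\<in>X. g (x, s)) < e"
      using e by (simp add: dist_real_def)
  qed
qed

text \<open>The clause on \<open>fC C f\<close> for every \<open>C > 0\<close> forces \<open>\<phi> s\<close> to dominate \<open>\<bar>f y u w\<bar>\<close> for all \<open>\<bar>w\<bar> \<le> s\<close>.
  The envelope \<open>\<psi>\<close> is therefore monotone, and unlike \<open>\<phi>\<close> it is continuous and bounded away from 0.\<close>
lemma nagumo_envelope:
  assumes f_cont: "continuous_on (E1 \<times> E2t \<times> UNIV) (\<lambda>(y,u,v). f y u v)"
    and nag: "nagumo E1 E2t f"
    and le: "a \<le> b" "m \<le> M" and sub: "{a..b} \<subseteq> E1" "{m..M} \<subseteq> E2t"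
  obtains \<psi> \<phi> :: "real \<Rightarrow> real" where
    "continuous_on UNIV \<psi>" "\<And>s. 1 \<le> \<psi> s" "\<And>s s'. \<bar>s'\<bar> \<le> \<bar>s\<bar> \<Longrightarrow> \<psi> s' \<le> \<psi> s"
    "\<And>y u v w. y \<in> {a..b} \<Longrightarrow> u \<in> {m..M} \<Longrightarrow> \<bar>w\<bar> \<le> \<bar>v\<bar> \<Longrightarrow> \<bar>f y u w\<bar> \<le> \<psi> v"
    "\<And>s. s > 0 \<Longrightarrow> \<psi> s \<le> 1 + \<phi> s"
    "\<And>r. r > 0 \<Longrightarrow> (\<integral>\<^sup>+ s. (ennreal s / ennreal (\<phi> s)) * indicator {r..} s \<partial>lborel) = \<infinity>"
proof -
  \<comment> \<open>Every \<open>w\<close> with \<open>\<bar>w\<bar> \<le> \<bar>s\<bar>\<close> has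
    the form \<open>\<sigma> * s\<close> with \<open>\<sigma>\<close> in \<open>{-1..1}\<close>; the
    supremum thus runs over a compact set that does not move with \<open>s\<close>.\<close>
  define X where "X = {a..b} \<times> {m..M} \<times> {-1..1::real}"
  define g where "g = (\<lambda>((y, u, \<sigma>), s). \<bar>f y u (\<sigma> * s)\<bar>)"
  have X: "compact X" "X \<noteq> {}" using le by (auto simp: X_def intro!: compact_Times)
  have g: "continuous_on (X \<times> UNIV) g"
  proof -
    have "continuous_on (X \<times> UNIV) (\<lambda>p. (\<lambda>(y,u,v). f y u v) (fst (fst p), fst (snd (fst p)), snd (snd (fst p)) * snd p))"
      by (rule continuous_on_compose2[OF f_cont]) (use sub in \<open>auto simp: X_def intro!: continuous_intros\<close>)
    then show ?thesis unfolding g_def by (auto simp: split_beta intro!: continuous_intros)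
  qed
  define \<psi> where "\<psi> s = 1 + (SUP x\<in>X. g (x, s))" for s
  have bdd: "bdd_above ((\<lambda>x. g (x, s)) ` X)" for s
    by (intro bounded_imp_bdd_above compact_imp_bounded compact_continuous_image X
        continuous_on_compose2[OF g]) (auto intro!: continuous_intros)
  have up: "\<bar>f y u w\<bar> \<le> \<psi> v - 1" if "y \<in> {a..b}" "u \<in> {m..M}" "\<bar>w\<bar> \<le> \<bar>v\<bar>" for y u v w
  proof -
    define \<sigma> where "\<sigma> = (if v = 0 then 0 else w / v)"
    have "\<bar>\<sigma>\<bar> \<le> 1" "w = \<sigma> * v" using that by (auto simp: \<sigma>_def divide_le_eq_1)
    then have "(y, u, \<sigma>) \<in> X" "g ((y, u, \<sigma>), v) = \<bar>f y u w\<bar>"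
      using that by (auto simp: X_def g_def)
    with cSUP_upper[OF this(1) bdd, of v] show ?thesis by (simp add: \<psi>_def)
  qed
  obtain y0 u0 where yu0: "y0 \<in> {a..b}" "u0 \<in> {m..M}" using le by (meson atLeastAtMost_iff order_refl)
  have "compact ({a..b} \<times> {m..M})" "{a..b} \<times> {m..M} \<subseteq> E1 \<times> E2t"
    using sub by (auto intro!: compact_Times)
  with nag obtain \<phi> where \<phi>: "\<forall>r>0. (\<integral>\<^sup>+ s. (ennreal s / ennreal (\<phi> s)) * indicator {r..} s \<partial>lborel) = \<infinity>"
    "\<forall>(y,u)\<in>{a..b} \<times> {m..M}. \<forall>v. \<bar>f y u v\<bar> \<le> \<phi> \<bar>v\<bar> \<and> (\<forall>C>0. \<bar>fC C f y u v\<bar> \<le> \<phi> \<bar>v\<bar>)"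
    unfolding nagumo_def by (smt (verit))
  show ?thesis
  proof (rule that[of \<psi> \<phi>])
    show "continuous_on UNIV \<psi>"
      unfolding \<psi>_def by (intro continuous_intros continuous_on_SUP_compact X g)
    show "1 \<le> \<psi> s" for s using up[OF yu0, of s s] by simp
    show "\<psi> s' \<le> \<psi> s" if "\<bar>s'\<bar> \<le> \<bar>s\<bar>" for s s'
    proof -
      have "(SUP x\<in>X. g (x, s')) \<le> \<psi> s - 1"
      proof (rule cSUP_least[OF X(2)])
        fix x assume x: "x \<in> X"
        obtain y u \<sigma> where x': "x = (y, u, \<sigma>)" by (cases x)
        have "\<bar>\<sigma> * s'\<bar> \<le> 1 * \<bar>s\<bar>" using x x' that
          unfolding abs_mult by (intro mult_mono) (auto simp: X_def)
        then show "g (x, s') \<le> \<psi> s - 1" using x x' by (auto simp: g_def X_def intro!: up)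
      qed
      then show ?thesis by (simp add: \<psi>_def)
    qed
    show "\<bar>f y u w\<bar> \<le> \<psi> v" if "y \<in> {a..b}" "u \<in> {m..M}" "\<bar>w\<bar> \<le> \<bar>v\<bar>" for y u v w
      using up[OF that] by simp
    show "(\<integral>\<^sup>+ s. (ennreal s / ennreal (\<phi> s)) * indicator {r..} s \<partial>lborel) = \<infinity>" if "r > 0" for r
      using \<phi>(1) that by blast
    fix s :: real assume s: "s > 0"
    \<comment> \<open>Truncation at level \<open>C = \<bar>\<sigma>\<bar> * s\<close> sends the
      slope \<open>sgn \<sigma> * s\<close>, whose modulus is \<open>s\<close>, to
      \<open>\<sigma> * s\<close>.\<close>
    have pos: "\<bar>f y u (\<sigma> * s)\<bar> \<le> \<phi> s" if "y \<in> {a..b}" "u \<in> {m..M}" "0 < \<bar>\<sigma>\<bar>" "\<bar>\<sigma>\<bar> \<le> 1" for y u \<sigma>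
    proof -
      have C: "\<bar>\<sigma>\<bar> * s > 0" "\<bar>\<sigma>\<bar> * s \<le> s" using that s by (auto simp: mult_le_cancel_right1)
      have "\<bar>fC (\<bar>\<sigma>\<bar> * s) f y u (sgn \<sigma> * s)\<bar> \<le> \<phi> \<bar>sgn \<sigma> * s\<bar>"
        using \<phi>(2) that C by blast
      moreover have "fC (\<bar>\<sigma>\<bar> * s) f y u (sgn \<sigma> * s) = f y u (\<sigma> * s)"
      proof -
        have "max (- (\<bar>\<sigma>\<bar> * s)) (min (sgn \<sigma> * s) (\<bar>\<sigma>\<bar> * s)) = \<sigma> * s"
        proof -
          have "max (- c) (min t c) = q" if "c \<le> s" "0 < c" "t = s \<and> q = c \<or> t = - s \<and> q = - c" for c t q :: real
            using that by (auto simp: min_def max_def)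
          from this[OF C(2,1), of "sgn \<sigma> * s" "\<sigma> * s"] show ?thesis
            using that by (cases "\<sigma> > 0") auto
        qed
        then show ?thesis by (simp add: fC_def)
      qed
      moreover have "\<bar>sgn \<sigma> * s\<bar> = s" using that s by (auto simp: sgn_if)
      ultimately show ?thesis by simp
    qed
    have zero: "\<bar>f y u 0\<bar> \<le> \<phi> s" if yu: "y \<in> {a..b}" "u \<in> {m..M}" for y u
    proof -
      have "continuous_on (closure {0<..<1}) (\<lambda>\<sigma>. \<bar>(\<lambda>(y,u,v). f y u v) (y, u, \<sigma> * s)\<bar>)"
        by (intro continuous_intros continuous_on_compose2[OF f_cont]) (use sub yu in auto)
      from continuous_le_on_closure[OF this, of 0 "\<phi> s"] show ?thesis using pos[OF yu] by auto
    qed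
    have "(SUP x\<in>X. g (x, s)) \<le> \<phi> s"
    proof (rule cSUP_least[OF X(2)])
      fix x assume x: "x \<in> X"
      obtain y u \<sigma> where x': "x = (y, u, \<sigma>)" by (cases x)
      show "g (x, s) \<le> \<phi> s"
        using x x' pos[of y u \<sigma>] zero[of y u] by (cases "\<sigma> = 0") (auto simp: g_def X_def)
    qed
    then show "\<psi> s \<le> 1 + \<phi> s" by (simp add: \<psi>_def)
  qed
qed

lemma mono_bounded_tendsto_at_top:
  fixes F :: "real \<Rightarrow> real"
  assumes mono: "\<And>x y. r \<le> x \<Longrightarrow> x \<le> y \<Longrightarrow> F x \<le> F y" and bd: "\<And>x. r \<le> x \<Longrightarrow> F x \<le> B"
  shows "(F \<longlongrightarrow> (SUP x\<in>{r..}. F x)) at_top"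
proof (rule order_tendstoI)
  have bdd: "bdd_above (F ` {r..})" using bd by (intro bdd_aboveI[of _ B]) auto
  fix c assume "c < (SUP x\<in>{r..}. F x)"
  then obtain x where x: "r \<le> x" "c < F x" using less_cSUP_iff[OF _ bdd] by auto
  show "eventually (\<lambda>x. c < F x) at_top"
    using eventually_ge_at_top[of x] by eventually_elim (use x mono in fastforce)
next
  have bdd: "bdd_above (F ` {r..})" using bd by (intro bdd_aboveI[of _ B]) auto
  fix c assume c: "(SUP x\<in>{r..}. F x) < c"
  show "eventually (\<lambda>x. F x < c) at_top"
    using eventually_ge_at_top[of r] by eventually_elim (use c cSUP_upper[OF _ bdd] in fastforce)
qed

text \<open>As \<open>\<psi>\<close> is even, so is the antiderivative \<open>F\<close> of
  \<open>s / \<psi> s\<close>. If \<open>F\<close> were bounded on the positive axis,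
  \<open>s / \<psi> s\<close> would have a finite integral; the divergence assumed for
  \<open>\<phi>\<close> has to be carried over to \<open>\<psi>\<close> to exclude this.\<close>

lemma nagumo_antiderivative:
  fixes \<psi> \<phi> :: "real \<Rightarrow> real"
  assumes cont: "continuous_on UNIV \<psi>" and ge1: "\<And>s. 1 \<le> \<psi> s"
    and mono: "\<And>s s'. \<bar>s'\<bar> \<le> \<bar>s\<bar> \<Longrightarrow> \<psi> s' \<le> \<psi> s"
    and \<phi>: "\<And>s. s > 0 \<Longrightarrow> \<psi> s \<le> 1 + \<phi> s"
    and div: "\<And>r. r > 0 \<Longrightarrow> (\<integral>\<^sup>+ s. (ennreal s / ennreal (\<phi> s)) * indicator {r..} s \<partial>lborel) = \<infinity>"
  obtains F where "\<And>x. (F has_real_derivative x / \<psi> x) (at x)"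
    "\<And>x y. \<bar>x\<bar> \<le> \<bar>y\<bar> \<Longrightarrow> F x \<le> F y" "\<And>B. \<exists>N>0. B < F N"
proof -
  have pos: "\<psi> s > 0" for s using ge1[of s] by linarith
  have c: "continuous_on UNIV (\<lambda>s. s / \<psi> s)"
    using cont pos by (intro continuous_intros) (auto simp: less_imp_neq[symmetric])
  have "\<exists>F. \<forall>x::real. -\<infinity> < ereal x \<longrightarrow> ereal x < \<infinity> \<longrightarrow> (F has_vector_derivative x / \<psi> x) (at x)"
    by (rule einterval_antiderivative) (use c in \<open>auto simp: continuous_on_eq_continuous_at\<close>)
  then obtain F where F: "(F has_real_derivative x / \<psi> x) (at x)" for x
    by (auto simp: has_real_derivative_iff_has_vector_derivative)
  have even: "\<psi> (- x) = \<psi> x" for x using mono[of x "-x"] mono[of "-x" x] by simp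
  have "((\<lambda>x. F x - F (- x)) has_real_derivative 0) (at x)" for x
    by (auto intro!: derivative_eq_intros DERIV_chain2[OF F] F simp: even)
  then have "F x - F (- x) = F 0 - F (- 0)" for x by (intro DERIV_isconst_all) auto
  then have Feven: "F (- x) = F x" for x by simp
  have Finc: "F x \<le> F y" if "0 \<le> x" "x \<le> y" for x y
    by (rule DERIV_nonneg_imp_nondecreasing[OF that(2)]) (use F pos that in \<open>auto intro!: exI divide_nonneg_pos\<close>)
  have Fabs: "F \<bar>x\<bar> = F x" for x by (auto simp: abs_if Feven)
  have "\<exists>N>0. B < F N" for B
  proof (rule ccontr)
    assume "\<not> (\<exists>N>0. B < F N)"
    then have B: "F x \<le> B" if "x > 0" for x using that by force
    show False
    \<comment> \<open>Where \<open>\<psi> \<ge> 2\<close>, the bound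
      \<open>\<psi> \<le> 1 + \<phi>\<close> gives \<open>\<phi> \<ge> \<psi> / 2 > 0\<close>, and
      the integrals compare. Otherwise \<open>\<phi>\<close> may vanish and make its integral
      infinite for free, but then \<open>\<psi> < 2\<close> on the positive axis and
      \<open>F\<close> grows at least linearly.\<close>
    proof (cases "\<exists>r>0. \<psi> r \<ge> 2")
      case True
      then obtain r where r: "r > 0" "\<psi> r \<ge> 2" by blast
      have \<psi>2: "\<psi> s \<ge> 2" if "s \<ge> r" for s using mono[of r s] r that by simp
      define T where "T = (SUP x\<in>{r..}. F x)"
      have T: "(F \<longlongrightarrow> T) at_top" unfolding T_def
        by (rule mono_bounded_tendsto_at_top[of _ _ B]) (use Finc B r in auto)
      have meas: "(\<lambda>s. s / \<psi> s) \<in> borel_measurable borel"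
        using c by (rule borel_measurable_continuous_onI)
      have "\<infinity> = (\<integral>\<^sup>+ s. (ennreal s / ennreal (\<phi> s)) * indicator {r..} s \<partial>lborel)" using div r by simp
      also have "\<dots> \<le> (\<integral>\<^sup>+ s. 2 * (ennreal (s / \<psi> s) * indicator {r..} s) \<partial>lborel)"
      proof (rule nn_integral_mono)
        fix s :: real
        have "ennreal s / ennreal (\<phi> s) \<le> 2 * ennreal (s / \<psi> s)" if s: "s \<ge> r"
        proof -
          have p: "s > 0" "\<phi> s > 0" "\<psi> s \<le> 2 * \<phi> s" using \<psi>2[OF s] \<phi>[of s] r s by auto
          have "s / \<phi> s \<le> 2 * (s / \<psi> s)" using p pos[of s] by (auto simp: field_simps)
          then have "ennreal (s / \<phi> s) \<le> ennreal (2 * (s / \<psi> s))" by (rule ennreal_leI)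
          also have "ennreal (2 * (s / \<psi> s)) = 2 * ennreal (s / \<psi> s)"
            using p pos[of s] by (subst ennreal_mult) auto
          finally show ?thesis using p by (simp add: divide_ennreal)
        qed
        then show "ennreal s / ennreal (\<phi> s) * indicator {r..} s \<le> 2 * (ennreal (s / \<psi> s) * indicator {r..} s)"
          by (auto simp: indicator_def)
      qed
      also have "\<dots> = 2 * (\<integral>\<^sup>+ s. ennreal (s / \<psi> s) * indicator {r..} s \<partial>lborel)"
        by (rule nn_integral_cmult) (use meas in auto)
      also have "\<dots> = 2 * ennreal (T - F r)"
        by (subst nn_integral_FTC_atLeast[OF meas F _ T])
           (use r pos in \<open>auto intro!: divide_nonneg_pos\<close>)
      also have "\<dots> < \<infinity>" by (simp add: ennreal_mult_less_top)
      finally show False by simp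
    next
      case False
      have low: "1 / 2 \<le> x / \<psi> x" if "x \<ge> 1" for x
      proof -
        have "\<psi> x \<le> 2" using False that by (meson less_le_not_le linear order_less_le_trans zero_less_one)
        then have "\<psi> x \<le> 2 * x" using that by linarith
        then show ?thesis using pos[of x] by (simp add: field_simps)
      qed
      \<comment> \<open>Chosen so that \<open>(x - 1) / 2\<close>, the guaranteed growth of
        \<open>F\<close> from 1 to \<open>x\<close>, exceeds \<open>B - F 1\<close>.\<close>
      define x where "x = 2 * (\<bar>B\<bar> + \<bar>F 1\<bar> + 1) + 1"
      have x: "x \<ge> 1" by (simp add: x_def)
      have "F 1 - 1 / 2 * 1 \<le> F x - 1 / 2 * x"
      proof (rule DERIV_nonneg_imp_nondecreasing[OF x])
        fix z :: real assume z: "1 \<le> z"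
        have "((\<lambda>x. F x - 1 / 2 * x) has_real_derivative z / \<psi> z - 1 / 2) (at z)"
          by (auto intro!: derivative_eq_intros F)
        then show "\<exists>y. ((\<lambda>x. F x - 1 / 2 * x) has_real_derivative y) (at z) \<and> 0 \<le> y"
          using low[OF z] by auto
      qed
      moreover have "F x \<le> B" using x by (intro B) simp
      ultimately show False unfolding x_def by argo
    qed
  qed
  moreover have "F x \<le> F y" if "\<bar>x\<bar> \<le> \<bar>y\<bar>" for x y
    using Finc[of "\<bar>x\<bar>" "\<bar>y\<bar>"] that by (simp add: Fabs)
  ultimately show ?thesis using that F by blast
qed

section \<open>A priori gradient bound and limits of solutions\<close>

text \<open>The derivative of \<open>F (v t)\<close> is \<open>v / \<psi> v * G\<close>, of modulus
  at most \<open>\<bar>v\<bar>\<close>. When \<open>v\<close> keeps its sign,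
  \<open>\<bar>v\<bar>\<close> is the derivative of \<open>c * u\<close> with \<open>c\<close> equal
  to 1 or -1, so \<open>F (v t) - c * u t\<close> decreases and \<open>F (v t) + c * u t\<close>
  increases.\<close>

lemma nagumo_transform_variation:
  assumes F: "\<And>x. (F has_real_derivative x / \<psi> x) (at x)" and pos: "\<And>x. 0 < \<psi> x"
    and sol: "solves_on G p q u v" and pq: "p \<le> q"
    and bd: "\<And>t. t \<in> {p..q} \<Longrightarrow> \<bar>G t (u t) (v t)\<bar> \<le> \<psi> (v t)"
    and sgn: "(\<forall>t\<in>{p..q}. 0 \<le> v t) \<or> (\<forall>t\<in>{p..q}. v t \<le> 0)"
  shows "\<bar>F (v q) - F (v p)\<bar> \<le> \<bar>u q - u p\<bar>"
proof -
  obtain c :: real where c: "\<bar>c\<bar> = 1" "\<And>t. t \<in> {p..q} \<Longrightarrow> c * v t = \<bar>v t\<bar>"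
  proof (cases "\<forall>t\<in>{p..q}. 0 \<le> v t")
    case True
    then show ?thesis using that[of 1] by auto
  next
    case False
    then show ?thesis using sgn that[of "-1"] by auto
  qed
  have "continuous_on UNIV F"
    using F by (meson DERIV_isCont continuous_at_imp_continuous_on)
  then have contF: "continuous_on {p..q} (\<lambda>t. F (v t))"
    by (rule continuous_on_compose2) (use solves_on_continuous[OF sol] in auto)
  have der: "((\<lambda>t. F (v t)) has_real_derivative v t / \<psi> (v t) * G t (u t) (v t)) (at t)" if "p < t" "t < q" for t
    using DERIV_chain2[OF F solves_onD_at(2)[OF sol that]] .
  have bound: "\<bar>v t / \<psi> (v t) * G t (u t) (v t)\<bar> \<le> c * v t" if "p < t" "t < q" for t
  proof -
    have "\<bar>v t / \<psi> (v t) * G t (u t) (v t)\<bar> = \<bar>v t\<bar> / \<psi> (v t) * \<bar>G t (u t) (v t)\<bar>"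
      using pos[of "v t"] by (simp add: abs_mult)
    also have "\<dots> \<le> \<bar>v t\<bar> / \<psi> (v t) * \<psi> (v t)"
      using pos[of "v t"] bd[of t] that by (intro mult_left_mono) auto
    also have "\<dots> = c * v t" using pos[of "v t"] c(2)[of t] that by simp
    finally show ?thesis .
  qed
  have "F (v q) - c * u q \<le> F (v p) - c * u p"
  proof (rule DERIV_nonpos_imp_decreasing_open[OF pq])
    fix t assume t: "p < t" "t < q"
    have "((\<lambda>t. F (v t) - c * u t) has_real_derivative v t / \<psi> (v t) * G t (u t) (v t) - c * v t) (at t)"
      by (intro DERIV_diff der DERIV_cmult solves_onD_at(1)[OF sol] t)
    moreover have "v t / \<psi> (v t) * G t (u t) (v t) - c * v t \<le> 0" using bound[OF t] by linarith
    ultimately show "\<exists>y. ((\<lambda>t. F (v t) - c * u t) has_real_derivative y) (at t) \<and> y \<le> 0" by blast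
  qed (intro continuous_intros contF solves_on_continuous[OF sol])
  moreover have "F (v p) + c * u p \<le> F (v q) + c * u q"
  proof (rule DERIV_nonneg_imp_increasing_open[OF pq])
    fix t assume t: "p < t" "t < q"
    have "((\<lambda>t. F (v t) + c * u t) has_real_derivative v t / \<psi> (v t) * G t (u t) (v t) + c * v t) (at t)"
      by (intro DERIV_add der DERIV_cmult solves_onD_at(1)[OF sol] t)
    moreover have "0 \<le> v t / \<psi> (v t) * G t (u t) (v t) + c * v t" using bound[OF t] by linarith
    ultimately show "\<exists>y. ((\<lambda>t. F (v t) + c * u t) has_real_derivative y) (at t) \<and> 0 \<le> y" by blast
  qed (intro continuous_intros contF solves_on_continuous[OF sol])
  ultimately have "\<bar>F (v q) - F (v p)\<bar> \<le> c * (u q - u p)" by (simp add: algebra_simps abs_le_iff)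
  also have "\<dots> \<le> \<bar>c\<bar> * \<bar>u q - u p\<bar>" by (metis abs_ge_self abs_mult)
  finally show ?thesis using c(1) by simp
qed

text \<open>Some mean value point \<open>\<xi>\<close> has
  \<open>\<bar>v \<xi>\<bar> \<le> (M - m) / (b - a)\<close>. Starting from \<open>\<xi>\<close>, or
  from a zero of \<open>v\<close> lying closer to \<open>t\<close>, the variation of
  \<open>F (v t)\<close> is at most that of \<open>u\<close>.\<close>

lemma nagumo_gradient_bound:
  assumes F: "\<And>x. (F has_real_derivative x / \<psi> x) (at x)" and pos: "\<And>x. 0 < \<psi> x"
    and Fmono: "\<And>x y. \<bar>x\<bar> \<le> \<bar>y\<bar> \<Longrightarrow> F x \<le> F y"
    and sol: "solves_on G a b u v" and ab: "a < b"
    and bd: "\<And>t. t \<in> {a..b} \<Longrightarrow> \<bar>G t (u t) (v t)\<bar> \<le> \<psi> (v t)"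
    and u: "\<And>t. t \<in> {a..b} \<Longrightarrow> u t \<in> {m..M}"
    and t: "t \<in> {a..b}"
  shows "F (v t) \<le> F ((M - m) / (b - a)) + (M - m)"
proof -
  define r where "r = (M - m) / (b - a)"
  have mM: "m \<le> M" using u[OF t] by simp
  have cont: "continuous_on {a..b} u" "continuous_on {a..b} v" by (rule solves_on_continuous[OF sol])+
  obtain \<xi> where \<xi>: "a < \<xi>" "\<xi> < b" "u b - u a = (b - a) * v \<xi>"
  proof -
    obtain l z where "a < z" "z < b" "(u has_real_derivative l) (at z)" "u b - u a = (b - a) * l"
      using MVT[OF ab cont(1)] solves_onD_at(1)[OF sol] real_differentiable_def by blast
    then show ?thesis using that[of z] DERIV_unique[OF _ solves_onD_at(1)[OF sol, of z]] by simp
  qed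
  have "\<bar>u b - u a\<bar> \<le> M - m" using u[of a] u[of b] ab by (simp add: abs_le_iff)
  then have "\<bar>v \<xi>\<bar> * (b - a) \<le> M - m" using \<xi>(3) ab by (simp add: abs_mult mult.commute)
  then have v\<xi>: "\<bar>v \<xi>\<bar> \<le> r" using ab by (simp add: r_def pos_le_divide_eq)
  have r: "r \<ge> 0" using v\<xi> by simp
  show ?thesis
  proof (cases "v t = 0")
    case True
    then show ?thesis using Fmono[of 0 r] r mM by (simp add: r_def)
  next
    case False
    \<comment> \<open>Let \<open>z\<close> be the zero of \<open>v\<close> between \<open>\<xi>\<close> and \<open>t\<close> nearest to \<open>t\<close> (or \<open>\<xi>\<close> itself): from \<open>z\<close> to \<open>t\<close>, \<open>v\<close> keeps its sign.\<close>
    let ?Z = "insert \<xi> {s \<in> closed_segment \<xi> t. v s = 0}"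
    have seg: "closed_segment \<xi> t \<subseteq> {a..b}" using \<xi> t by (auto simp: closed_segment_eq_real_ivl)
    have "continuous_on (closed_segment \<xi> t) v" using continuous_on_subset[OF cont(2) seg] .
    then have "closed {s \<in> closed_segment \<xi> t. v s = 0}"
      using continuous_closed_preimage_constant[of "closed_segment \<xi> t" v 0] by simp
    then have "compact ?Z"
      by (intro compact_insert) (simp add: compact_eq_bounded_closed bounded_subset[OF bounded_closed_segment[of \<xi> t]])
    then obtain z where z: "z \<in> ?Z" and zmin: "\<And>s. s \<in> ?Z \<Longrightarrow> \<bar>t - z\<bar> \<le> \<bar>t - s\<bar>"
      using continuous_attains_inf[of ?Z "\<lambda>s. \<bar>t - s\<bar>"] by (fastforce intro!: continuous_intros)
    have z_seg: "z \<in> closed_segment \<xi> t" using z by auto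
    have zr: "\<bar>v z\<bar> \<le> \<bar>r\<bar>" using z v\<xi> r by auto
    \<comment> \<open>A strict sign change between \<open>s\<close> and \<open>t\<close> would
      produce a zero \<open>q\<close> of \<open>v\<close> in between. Minimality of \<open>z\<close>
      forces \<open>q = s\<close>, where \<open>v\<close> is nonzero.\<close>
    have same: "v s * v t \<ge> 0" if s: "s \<in> closed_segment z t" for s
    proof (rule ccontr)
      assume neg: "\<not> v s * v t \<ge> 0"
      have sub: "closed_segment s t \<subseteq> closed_segment \<xi> t"
        using s z_seg by (auto simp: closed_segment_eq_real_ivl split: if_splits)
      have "is_interval (v ` closed_segment s t)"
        unfolding is_interval_connected_1
        by (intro connected_continuous_image continuous_on_subset[OF cont(2)] connected_segment) (use sub seg in auto)
      moreover have "v s \<in> v ` closed_segment s t" "v t \<in> v ` closed_segment s t" by auto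
      moreover have "v s \<le> 0 \<and> 0 \<le> v t \<or> v t \<le> 0 \<and> 0 \<le> v s"
        using neg by (auto simp: not_le mult_less_0_iff)
      ultimately have "0 \<in> v ` closed_segment s t" by (meson mem_is_interval_1_I)
      then obtain q where q: "q \<in> closed_segment s t" "v q = 0" by auto
      then have "\<bar>t - z\<bar> \<le> \<bar>t - q\<bar>" using sub by (intro zmin) auto
      then have "q = s" using q(1) s by (auto simp: closed_segment_eq_real_ivl split: if_splits)
      then show False using q(2) neg by simp
    qed
    have sgn: "(\<forall>s\<in>closed_segment z t. 0 \<le> v s) \<or> (\<forall>s\<in>closed_segment z t. v s \<le> 0)"
      using same False by (cases "v t > 0") (auto simp: zero_le_mult_iff not_less)
    have "\<bar>F (v t) - F (v z)\<bar> \<le> \<bar>u t - u z\<bar>"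
    proof (cases "z \<le> t")
      case True
      show ?thesis
        by (rule nagumo_transform_variation[OF F pos solves_on_subset[OF sol] True bd])
           (use True sgn z_seg seg t in \<open>auto simp: closed_segment_eq_real_ivl split: if_splits\<close>)
    next
      case False
      then have tz: "t \<le> z" by simp
      have "\<bar>F (v z) - F (v t)\<bar> \<le> \<bar>u z - u t\<bar>"
        by (rule nagumo_transform_variation[OF F pos solves_on_subset[OF sol] tz bd])
           (use False sgn z_seg seg t in \<open>auto simp: closed_segment_eq_real_ivl split: if_splits\<close>)
      then show ?thesis by (simp add: abs_minus_commute)
    qed
    also have "\<dots> \<le> M - m" using u[OF t] u[of z] z_seg seg by (auto simp: abs_le_iff)
    finally show ?thesis using Fmono[OF zr] by (simp add: r_def)
  qed
qed

text \<open>\<open>N\<close> is found from the unboundedness of \<open>F\<close> before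
  \<open>G\<close> is fixed, so it is common to all right-hand sides that along the solution take
  values of \<open>f\<close> at slopes no larger than \<open>v t\<close>. This covers
  \<open>f\<close> itself, with \<open>w = v t\<close>, and its truncation at any level.\<close>

lemma nagumo_apriori_bound:
  assumes f_cont: "continuous_on (E1 \<times> E2t \<times> UNIV) (\<lambda>(y,u,v). f y u v)"
    and nag: "nagumo E1 E2t f"
    and ab: "a < b" and mM: "m \<le> M" and sub: "{a..b} \<subseteq> E1" "{m..M} \<subseteq> E2t"
  shows "\<exists>N>0. \<forall>G u v. solves_on G a b u v \<longrightarrow> (\<forall>t\<in>{a..b}. u t \<in> {m..M}) \<longrightarrow>
      (\<forall>t\<in>{a..b}. \<exists>w. \<bar>w\<bar> \<le> \<bar>v t\<bar> \<and> G t (u t) (v t) = f t (u t) w) \<longrightarrow>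
      (\<forall>t\<in>{a..b}. \<bar>v t\<bar> \<le> N)"
proof -
  obtain \<psi> \<phi> :: "real \<Rightarrow> real" where \<psi>: "continuous_on UNIV \<psi>" "\<And>s. 1 \<le> \<psi> s"
    "\<And>s s'. \<bar>s'\<bar> \<le> \<bar>s\<bar> \<Longrightarrow> \<psi> s' \<le> \<psi> s"
    "\<And>y u v w. y \<in> {a..b} \<Longrightarrow> u \<in> {m..M} \<Longrightarrow> \<bar>w\<bar> \<le> \<bar>v\<bar> \<Longrightarrow> \<bar>f y u w\<bar> \<le> \<psi> v"
    "\<And>s. s > 0 \<Longrightarrow> \<psi> s \<le> 1 + \<phi> s"
    "\<And>r. r > 0 \<Longrightarrow> (\<integral>\<^sup>+ s. (ennreal s / ennreal (\<phi> s)) * indicator {r..} s \<partial>lborel) = \<infinity>"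
    by (rule nagumo_envelope[OF f_cont nag less_imp_le[OF ab] mM sub]) blast
  obtain F where F: "\<And>x. (F has_real_derivative x / \<psi> x) (at x)"
    "\<And>x y. \<bar>x\<bar> \<le> \<bar>y\<bar> \<Longrightarrow> F x \<le> F y" "\<And>B. \<exists>N>0. B < F N"
    by (rule nagumo_antiderivative[OF \<psi>(1-3,5,6)], assumption+) (rule that, blast+)
  obtain N where N: "N > 0" "F ((M - m) / (b - a)) + (M - m) < F N" using F(3) by blast
  show ?thesis
  proof (intro exI[of _ N] conjI allI impI ballI N(1))
    fix G u v t
    assume sol: "solves_on G a b u v" and u: "\<forall>t\<in>{a..b}. u t \<in> {m..M}"
      and G: "\<forall>t\<in>{a..b}. \<exists>w. \<bar>w\<bar> \<le> \<bar>v t\<bar> \<and> G t (u t) (v t) = f t (u t) w"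
      and t: "t \<in> {a..b}"
    have "F (v t) \<le> F ((M - m) / (b - a)) + (M - m)"
    proof (rule nagumo_gradient_bound[OF F(1) _ F(2) sol ab _ u[rule_format] t])
      show "0 < \<psi> x" for x using \<psi>(2)[of x] by linarith
      show "\<bar>G t (u t) (v t)\<bar> \<le> \<psi> (v t)" if "t \<in> {a..b}" for t
        using bspec[OF G that] \<psi>(4)[OF that bspec[OF u that]] by metis
    qed
    then show "\<bar>v t\<bar> \<le> N" using N F(2)[of N "v t"] by (cases "\<bar>v t\<bar> \<le> N") auto
  qed
qed

section \<open>Lipschitz constants on boxes and limits of solutions\<close>

text \<open>The joint local constants in \<open>(t, u, v)\<close> restrict to local constants in
  \<open>(u, v)\<close> for fixed \<open>t\<close>; compactness of the box turns these into a single
  one.\<close>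

lemma loc_lipschitz_on_box:
  assumes f_cont: "continuous_on (E1 \<times> E2 \<times> UNIV) (\<lambda>(y,u,v). f y u v)"
    and f_lip: "loc_lipschitz_on (E1 \<times> E2 \<times> UNIV) f"
    and sub: "{a..b} \<subseteq> E1" "{m..M} \<subseteq> E2"
  obtains L where "L \<ge> 0"
    "\<And>t u v u' v'. t \<in> {a..b} \<Longrightarrow> u \<in> {m..M} \<Longrightarrow> u' \<in> {m..M} \<Longrightarrow> \<bar>v\<bar> \<le> C \<Longrightarrow> \<bar>v'\<bar> \<le> C \<Longrightarrow>
      \<bar>f t u v - f t u' v'\<bar> \<le> L * (\<bar>u - u'\<bar> + \<bar>v - v'\<bar>)"
proof -
  define X where "X = {m..M} \<times> {-C..C}"
  define g where "g t = (\<lambda>(u, v). f t u v)" for t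
  have "local_lipschitz {a..b} X g"
    unfolding local_lipschitz_def
  proof (intro ballI)
    fix x t assume x: "x \<in> X" and t: "t \<in> {a..b}"
    then have "(t, x) \<in> E1 \<times> E2 \<times> UNIV" using sub by (auto simp: X_def)
    with f_lip obtain e L where e: "e > 0" and L: "\<And>q r. q \<in> ball (t, x) e \<inter> (E1 \<times> E2 \<times> UNIV) \<Longrightarrow>
        r \<in> ball (t, x) e \<inter> (E1 \<times> E2 \<times> UNIV) \<Longrightarrow>
        \<bar>(case q of (y,u,v) \<Rightarrow> f y u v) - (case r of (y,u,v) \<Rightarrow> f y u v)\<bar> \<le> L * dist q r"
      unfolding loc_lipschitz_on_def by blast
    \<comment> \<open>With both components within \<open>e/4\<close>, the distance in the product is
      at most \<open>e/2\<close>, which stays inside the open ball.\<close>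
    have near: "(s, y) \<in> ball (t, x) e \<inter> (E1 \<times> E2 \<times> UNIV)"
      if "s \<in> cball t (e/4) \<inter> {a..b}" "y \<in> cball x (e/4) \<inter> X" for s y
    proof -
      have "dist (t, x) (s, y) \<le> dist t s + dist x y"
        unfolding dist_Pair_Pair using sqrt_sum_squares_le_sum[of "dist t s" "dist x y"] by simp
      then show ?thesis using that sub e by (auto simp: X_def)
    qed
    have "\<forall>s\<in>cball t (e/4) \<inter> {a..b}. \<bar>L\<bar>-lipschitz_on (cball x (e/4) \<inter> X) (g s)"
    proof (intro ballI lipschitz_onI)
      fix s y z assume s: "s \<in> cball t (e/4) \<inter> {a..b}"
        and y: "y \<in> cball x (e/4) \<inter> X" and z: "z \<in> cball x (e/4) \<inter> X"
      have "dist (g s y) (g s z) \<le> L * dist (s, y) (s, z)"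
        using L[OF near[OF s y] near[OF s z]] by (simp add: g_def dist_real_def split_beta)
      also have "\<dots> \<le> \<bar>L\<bar> * dist y z" by (simp add: dist_Pair_Pair mult_right_mono)
      finally show "dist (g s y) (g s z) \<le> \<bar>L\<bar> * dist y z" .
    qed simp
    then show "\<exists>u>0. \<exists>L. \<forall>s\<in>cball t u \<inter> {a..b}. L-lipschitz_on (cball x u \<inter> X) (g s)"
      using e by (intro exI[of _ "e/4"] conjI exI) auto
  qed
  moreover have "compact X" "compact {a..b}" by (auto simp: X_def intro!: compact_Times)
  moreover have "continuous_on {a..b} (\<lambda>t. g t x)" if x: "x \<in> X" for x
  proof -
    have "continuous_on {a..b} (\<lambda>t. (\<lambda>(y,u,v). f y u v) (t, x))"
      by (rule continuous_on_compose2[OF f_cont]) (use x sub in \<open>auto simp: X_def intro!: continuous_intros\<close>)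
    then show ?thesis by (simp add: g_def)
  qed
  ultimately obtain L where L: "\<And>t. t \<in> {a..b} \<Longrightarrow> L-lipschitz_on X (g t)"
    using local_lipschitz_compact_implies_lipschitz by blast
  show ?thesis
  proof (rule that[of "\<bar>L\<bar>"])
    fix t u v u' v' assume *: "t \<in> {a..b}" "u \<in> {m..M}" "u' \<in> {m..M}" "\<bar>v\<bar> \<le> C" "\<bar>v'\<bar> \<le> C"
    have "dist (g t (u, v)) (g t (u', v')) \<le> L * dist (u, v) (u', v')"
      by (rule lipschitz_onD[OF L]) (use * in \<open>auto simp: X_def\<close>)
    also have "\<dots> \<le> \<bar>L\<bar> * (\<bar>u - u'\<bar> + \<bar>v - v'\<bar>)"
      using norm_Pair_le[of "u - u'" "v - v'"] by (intro mult_mono) (auto simp: dist_norm)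
    finally show "\<bar>f t u v - f t u' v'\<bar> \<le> \<bar>L\<bar> * (\<bar>u - u'\<bar> + \<bar>v - v'\<bar>)"
      by (simp add: g_def dist_real_def)
  qed simp
qed

lemma C2_onD:
  assumes "C2_on S g" "open S" "x \<in> S"
  shows "(g has_real_derivative deriv g x) (at x)"
    "(deriv g has_real_derivative deriv (deriv g) x) (at x)"
proof -
  obtain g' g'' where g: "\<And>x. x \<in> S \<Longrightarrow> (g has_real_derivative g' x) (at x)"
    "\<And>x. x \<in> S \<Longrightarrow> (g' has_real_derivative g'' x) (at x)"
    using assms(1) unfolding C2_on_def by blast
  have d: "deriv g x = g' x" if "x \<in> S" for x using g(1)[OF that] by (rule DERIV_imp_deriv)
  show "(g has_real_derivative deriv g x) (at x)" using g(1) d assms(3) by simp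
  have "(deriv g has_real_derivative g'' x) (at x)"
    by (rule has_field_derivative_transform_within_open[OF g(2)[OF assms(3)] assms(2,3)]) (simp add: d)
  then show "(deriv g has_real_derivative deriv (deriv g) x) (at x)"
    using DERIV_imp_deriv by metis
qed

text \<open>Termwise differentiation yields some limit \<open>h\<close> with derivative
  \<open>g'\<close>; uniqueness of limits identifies it with the prescribed \<open>g\<close> on
  \<open>S\<close>.\<close>

lemma has_real_derivative_uniform_limit:
  fixes f :: "nat \<Rightarrow> real \<Rightarrow> real"
  assumes S: "convex S"
    and df: "\<And>n x. x \<in> S \<Longrightarrow> (f n has_real_derivative f' n x) (at x within S)"
    and ul: "uniform_limit S f' g' sequentially"
    and lim: "\<And>x. x \<in> S \<Longrightarrow> (\<lambda>n. f n x) \<longlonglongrightarrow> g x"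
    and x: "x \<in> S"
  shows "(g has_real_derivative g' x) (at x within S)"
proof -
  have "\<exists>h. \<forall>x\<in>S. (\<lambda>n. f n x) \<longlonglongrightarrow> h x \<and> (h has_derivative (*) (g' x)) (at x within S)"
  proof (rule has_derivative_sequence[where f = f and f' = "\<lambda>n x. (*) (f' n x)", OF S])
    show "x \<in> S" "(\<lambda>n. f n x) \<longlonglongrightarrow> g x" using x lim by auto
    show "(f n has_derivative (*) (f' n x)) (at x within S)" if "x \<in> S" for n x
      using df[OF that] by (simp add: has_field_derivative_def)
    fix e :: real assume e: "e > 0"
    show "\<forall>\<^sub>F n in sequentially. \<forall>x\<in>S. \<forall>h. norm (f' n x * h - g' x * h) \<le> e * norm h"
      using uniform_limitD[OF ul e]
    proof eventually_elim
      case (elim n)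
      show ?case
      proof (intro ballI allI)
        fix x h assume "x \<in> S"
        then have "\<bar>f' n x - g' x\<bar> * \<bar>h\<bar> \<le> e * \<bar>h\<bar>"
          using elim by (intro mult_right_mono) (auto simp: dist_real_def less_imp_le)
        then show "norm (f' n x * h - g' x * h) \<le> e * norm h"
          by (simp flip: left_diff_distrib abs_mult)
      qed
    qed
  qed
  then obtain h where h: "\<And>x. x \<in> S \<Longrightarrow> (\<lambda>n. f n x) \<longlonglongrightarrow> h x"
    "\<And>x. x \<in> S \<Longrightarrow> (h has_real_derivative g' x) (at x within S)"
    by (auto simp: has_field_derivative_def)
  have "h y = g y" if "y \<in> S" for y using LIMSEQ_unique[OF h(1)[OF that] lim[OF that]] .
  then show ?thesis by (intro has_field_derivative_transform_within[OF h(2)[OF x] zero_less_one x])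
qed

text \<open>By stability the distance of two solutions on \<open>{p..q}\<close> is controlled by
  their distance at \<open>c\<close>, so convergence at \<open>c\<close> makes both sequences
  uniformly Cauchy. The Lipschitz bound carries this over to the right-hand sides, and the system
  passes to the limit.\<close>

lemma solves_on_limit:
  assumes sol: "\<And>n::nat. solves_on f p q (u n) (v n)" and c: "c \<in> {p..q}"
    and bd: "\<And>n t. t \<in> {p..q} \<Longrightarrow> u n t \<in> {m..M}" "\<And>n t. t \<in> {p..q} \<Longrightarrow> \<bar>v n t\<bar> \<le> N"
    and L: "L \<ge> 0"
    and lip: "\<And>t u v u' v'. t \<in> {p..q} \<Longrightarrow> u \<in> {m..M} \<Longrightarrow> u' \<in> {m..M} \<Longrightarrow> \<bar>v\<bar> \<le> N \<Longrightarrow> \<bar>v'\<bar> \<le> N \<Longrightarrow>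
      \<bar>f t u v - f t u' v'\<bar> \<le> L * (\<bar>u - u'\<bar> + \<bar>v - v'\<bar>)"
    and conv: "convergent (\<lambda>n. u n c)" "convergent (\<lambda>n. v n c)"
  obtains U V where "solves_on f p q U V"
    "\<And>t. t \<in> {p..q} \<Longrightarrow> (\<lambda>n. u n t) \<longlonglongrightarrow> U t" "\<And>t. t \<in> {p..q} \<Longrightarrow> (\<lambda>n. v n t) \<longlonglongrightarrow> V t"
proof -
  define R where "R = exp ((1 + 3 * L) * (q - p) / 2)"
  have R: "R > 0" by (simp add: R_def)
  have diff: "\<bar>u i t - u j t\<bar> \<le> R * (\<bar>u i c - u j c\<bar> + \<bar>v i c - v j c\<bar>) \<and>
      \<bar>v i t - v j t\<bar> \<le> R * (\<bar>u i c - u j c\<bar> + \<bar>v i c - v j c\<bar>)" if t: "t \<in> {p..q}" for i j t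
  proof -
    let ?D = "\<bar>u i c - u j c\<bar> + \<bar>v i c - v j c\<bar>"
    have "(u i t - u j t)\<^sup>2 + (v i t - v j t)\<^sup>2 \<le>
        ((u i c - u j c)\<^sup>2 + (v i c - v j c)\<^sup>2) * exp ((1 + 3 * L) * \<bar>t - c\<bar>)"
      by (rule solves_on_stability[OF sol sol L lip]) (use bd c t in auto)
    also have "\<dots> \<le> ?D\<^sup>2 * exp ((1 + 3 * L) * (q - p))"
    proof (intro mult_mono)
      show "(u i c - u j c)\<^sup>2 + (v i c - v j c)\<^sup>2 \<le> ?D\<^sup>2" by (simp add: power2_sum)
      have "(1 + 3 * L) * \<bar>t - c\<bar> \<le> (1 + 3 * L) * (q - p)"
        using L t c by (intro mult_left_mono) auto
      then show "exp ((1 + 3 * L) * \<bar>t - c\<bar>) \<le> exp ((1 + 3 * L) * (q - p))" by simp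
    qed auto
    also have "\<dots> = (R * ?D)\<^sup>2" by (simp add: R_def power_mult_distrib flip: exp_double)
    finally have *: "(u i t - u j t)\<^sup>2 + (v i t - v j t)\<^sup>2 \<le> (R * ?D)\<^sup>2" .
    have "(u i t - u j t)\<^sup>2 \<le> (R * ?D)\<^sup>2" "(v i t - v j t)\<^sup>2 \<le> (R * ?D)\<^sup>2"
      using * zero_le_power2[of "v i t - v j t"] zero_le_power2[of "u i t - u j t"] by linarith+
    then have "\<bar>u i t - u j t\<bar> \<le> \<bar>R * ?D\<bar>" "\<bar>v i t - v j t\<bar> \<le> \<bar>R * ?D\<bar>"
      by (simp_all only: abs_le_square_iff)
    then show ?thesis using R by (simp add: abs_mult)
  qed
  have cau: "\<exists>K. \<forall>i\<ge>K. \<forall>j\<ge>K. R * (\<bar>u i c - u j c\<bar> + \<bar>v i c - v j c\<bar>) < e" if e: "e > 0" for e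
  proof -
    have e': "e / (2 * R) > 0" using e R by simp
    obtain K1 where K1: "\<And>i j. i \<ge> K1 \<Longrightarrow> j \<ge> K1 \<Longrightarrow> \<bar>u i c - u j c\<bar> < e / (2 * R)"
      using conv(1)[THEN convergent_Cauchy] e' unfolding Cauchy_def dist_real_def by metis
    obtain K2 where K2: "\<And>i j. i \<ge> K2 \<Longrightarrow> j \<ge> K2 \<Longrightarrow> \<bar>v i c - v j c\<bar> < e / (2 * R)"
      using conv(2)[THEN convergent_Cauchy] e' unfolding Cauchy_def dist_real_def by metis
    have "R * (\<bar>u i c - u j c\<bar> + \<bar>v i c - v j c\<bar>) < e" if "i \<ge> max K1 K2" "j \<ge> max K1 K2" for i j
    proof -
      have "\<bar>u i c - u j c\<bar> + \<bar>v i c - v j c\<bar> < e / (2 * R) + e / (2 * R)"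
        using K1[of i j] K2[of i j] that by auto
      then have "R * (\<bar>u i c - u j c\<bar> + \<bar>v i c - v j c\<bar>) < R * (e / (2 * R) + e / (2 * R))"
        using R by (rule mult_strict_left_mono)
      then show ?thesis using R by simp
    qed
    then show ?thesis by blast
  qed
  have "uniformly_Cauchy_on {p..q} u" "uniformly_Cauchy_on {p..q} v"
    unfolding uniformly_Cauchy_on_def dist_real_def using cau diff by (meson le_less_trans)+
  then obtain U V where U: "uniform_limit {p..q} u U sequentially" and V: "uniform_limit {p..q} v V sequentially"
    by (meson Cauchy_uniformly_convergent uniformly_convergent_on_def)
  have limU: "(\<lambda>n. u n t) \<longlonglongrightarrow> U t" and limV: "(\<lambda>n. v n t) \<longlonglongrightarrow> V t" if "t \<in> {p..q}" for t
    using tendsto_uniform_limitI[OF U that] tendsto_uniform_limitI[OF V that] .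
  have Ubd: "U t \<in> {m..M}" if t: "t \<in> {p..q}" for t
    using LIMSEQ_le_const[OF limU[OF t], of m] LIMSEQ_le_const2[OF limU[OF t], of M] bd(1)[OF t] by auto
  have Vbd: "\<bar>V t\<bar> \<le> N" if t: "t \<in> {p..q}" for t
    using LIMSEQ_le_const2[OF tendsto_rabs[OF limV[OF t]], of N] bd(2)[OF t] by auto
  have W: "uniform_limit {p..q} (\<lambda>n t. f t (u n t) (v n t)) (\<lambda>t. f t (U t) (V t)) sequentially"
  proof (rule uniform_limitI)
    fix e :: real assume e: "e > 0"
    \<comment> \<open>Dividing by \<open>L + 1\<close> gives \<open>L * (d + d) < e\<close> and
      remains meaningful for \<open>L = 0\<close>.\<close>
    define d where "d = e / (L + 1) / 2"
    have "d > 0" using e L by (simp add: d_def)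
    have "d + d = e / (L + 1)" unfolding d_def by (rule field_sum_of_halves)
    then have "L * (d + d) < e" using e L by (simp add: pos_divide_less_eq algebra_simps)
    note d = \<open>d > 0\<close> this
    show "\<forall>\<^sub>F n in sequentially. \<forall>t\<in>{p..q}. dist (f t (u n t) (v n t)) (f t (U t) (V t)) < e"
      using uniform_limitD[OF U d(1)] uniform_limitD[OF V d(1)]
    proof eventually_elim
      case (elim n)
      show ?case
      proof
        fix t assume t: "t \<in> {p..q}"
        have "dist (f t (u n t) (v n t)) (f t (U t) (V t)) \<le> L * (\<bar>u n t - U t\<bar> + \<bar>v n t - V t\<bar>)"
          unfolding dist_real_def by (rule lip) (use t bd Ubd Vbd in auto)
        also have "\<dots> \<le> L * (d + d)"
          using elim t L by (intro mult_left_mono add_mono) (auto simp: dist_real_def less_imp_le)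
        finally show "dist (f t (u n t) (v n t)) (f t (U t) (V t)) < e" using d(2) by simp
      qed
    qed
  qed
  have "solves_on f p q U V"
    unfolding solves_on_def
  proof (intro ballI conjI)
    fix t assume t: "t \<in> {p..q}"
    show "(U has_real_derivative V t) (at t within {p..q})"
      by (rule has_real_derivative_uniform_limit[OF _ solves_onD(1)[OF sol] V limU t]) auto
    show "(V has_real_derivative f t (U t) (V t)) (at t within {p..q})"
      by (rule has_real_derivative_uniform_limit[OF _ solves_onD(2)[OF sol] W limV t]) auto
  qed
  then show ?thesis using that limU limV by blast
qed

section \<open>Truncation and exhaustion\<close>

text \<open>The order of the steps matters: comparison puts the truncated solution between
  \<open>\<alpha>\<close> and \<open>\<beta>\<close>, only then does the a priori bound apply, and
  as \<open>N\<close> is fixed before the level \<open>C\<close> it shows the truncation of the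
  slope to be inactive.\<close>

lemma ordered_dirichlet_solution:
  assumes E2t: "E2 \<subseteq> E2t"
    and f_cont: "continuous_on (E1 \<times> E2t \<times> UNIV) (\<lambda>(y,u,v). f y u v)"
    and f_lip: "loc_lipschitz_on (E1 \<times> E2 \<times> UNIV) f"
    and f_nagumo: "nagumo E1 E2t f"
    and \<alpha>_C: "continuous_on E1 \<alpha>" "\<alpha> ` E1 \<subseteq> E2"
    and \<beta>_C: "continuous_on E1 \<beta>" "\<beta> ` E1 \<subseteq> E2"
    and \<alpha>_X: "classX E1 E2t \<alpha>" and \<beta>_X: "classX E1 E2t \<beta>"
    and le: "\<forall>y\<in>E1. \<alpha> y \<le> \<beta> y"
    and sub: "subsolution E1 E2t f \<alpha>" and super: "supersolution E1 E2t f \<beta>"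
    and ab: "a < b" and ab_sub: "{a..b} \<subseteq> E1"
    and mM: "m \<le> M" "{m..M} \<subseteq> E2" "\<And>t. t \<in> {a..b} \<Longrightarrow> m \<le> \<alpha> t" "\<And>t. t \<in> {a..b} \<Longrightarrow> \<beta> t \<le> M"
  obtains u v where "solves_on f a b u v" "\<And>t. t \<in> {a..b} \<Longrightarrow> \<alpha> t \<le> u t \<and> u t \<le> \<beta> t"
proof -
  have f_cont2: "continuous_on (E1 \<times> E2 \<times> UNIV) (\<lambda>(y,u,v). f y u v)"
    by (rule continuous_on_subset[OF f_cont]) (use E2t in auto)
  have mM_t: "{m..M} \<subseteq> E2t" using mM(2) E2t by blast
  have \<alpha>\<beta>: "\<alpha> t \<le> \<beta> t" if "t \<in> {a..b}" for t using le ab_sub that by auto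
  have cont: "continuous_on {a..b} \<alpha>" "continuous_on {a..b} \<beta>"
    using \<alpha>_C(1) \<beta>_C(1) ab_sub continuous_on_subset by blast+
  obtain N where N: "N > 0" and apriori:
    "\<forall>G u v. solves_on G a b u v \<longrightarrow> (\<forall>t\<in>{a..b}. u t \<in> {m..M}) \<longrightarrow>
      (\<forall>t\<in>{a..b}. \<exists>w. \<bar>w\<bar> \<le> \<bar>v t\<bar> \<and> G t (u t) (v t) = f t (u t) w) \<longrightarrow>
      (\<forall>t\<in>{a..b}. \<bar>v t\<bar> \<le> N)"
    using nagumo_apriori_bound[OF f_cont f_nagumo ab mM(1) ab_sub mM_t] by (elim exE conjE) (rule that)
  obtain B1 where B1: "\<And>y. y \<in> {a..b} \<Longrightarrow> \<alpha> differentiable (at y) \<Longrightarrow> \<bar>deriv \<alpha> y\<bar> \<le> B1"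
    using \<alpha>_X ab_sub unfolding classX_def by (meson compact_Icc)
  obtain B2 where B2: "\<And>y. y \<in> {a..b} \<Longrightarrow> \<beta> differentiable (at y) \<Longrightarrow> \<bar>deriv \<beta> y\<bar> \<le> B2"
    using \<beta>_X ab_sub unfolding classX_def by (meson compact_Icc)
  \<comment> \<open>\<open>N\<close> keeps the slope of the final solution below the truncation
    level. \<open>B1\<close> and \<open>B2\<close> ensure that slopes of \<open>\<alpha>\<close> and
    \<open>\<beta>\<close> are not truncated, so that their differential inequalities survive the
    passage from \<open>f\<close> to \<open>G\<close>.\<close>
  define C where "C = max N (max B1 B2)"
  have C: "C > 0" "N \<le> C" "B1 \<le> C" "B2 \<le> C" using N by (auto simp: C_def)
  obtain L where L: "L \<ge> 0" and lip:
    "\<And>t u v u' v'. t \<in> {a..b} \<Longrightarrow> u \<in> {m..M} \<Longrightarrow> u' \<in> {m..M} \<Longrightarrow> \<bar>v\<bar> \<le> C \<Longrightarrow> \<bar>v'\<bar> \<le> C \<Longrightarrow>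
      \<bar>f t u v - f t u' v'\<bar> \<le> L * (\<bar>u - u'\<bar> + \<bar>v - v'\<bar>)"
    using loc_lipschitz_on_box[OF f_cont2 f_lip ab_sub mM(2)] by blast
  define cu where "cu t u = max (\<alpha> t) (min (\<beta> t) u)" for t u
  define cv where "cv v = max (- C) (min v C)" for v
  have cv: "\<bar>cv v\<bar> \<le> C" "\<bar>cv v - cv v'\<bar> \<le> \<bar>v - v'\<bar>" "\<bar>cv v\<bar> \<le> \<bar>v\<bar>" for v v'
    using C(1) by (auto simp: cv_def)
  have cv_id: "cv v = v" if "\<bar>v\<bar> \<le> C" for v using that by (auto simp: cv_def)
  have cu: "cu t u \<in> {m..M}" if "t \<in> {a..b}" for t u
    using mM(3,4)[OF that] \<alpha>\<beta>[OF that] by (auto simp: cu_def)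
  have cu_lip: "\<bar>cu t u - cu t u'\<bar> \<le> \<bar>u - u'\<bar>" for t u u' by (auto simp: cu_def)
  \<comment> \<open>The penalty \<open>max (- 1) (min 1 (u - cu t u))\<close> makes the differential inequality strict
    wherever \<open>u\<close> leaves the band between \<open>\<alpha>\<close> and \<open>\<beta>\<close>.\<close>
  define G where "G t u v = f t (cu t u) (cv v) + max (- 1) (min 1 (u - cu t u))" for t u v
  have cont_cu: "continuous_on ({a..b} \<times> UNIV \<times> UNIV) (\<lambda>p. cu (fst p) (fst (snd p)))"
    unfolding cu_def
    by (intro continuous_intros continuous_on_compose2[OF cont(1)] continuous_on_compose2[OF cont(2)]) auto
  then have "continuous_on ({a..b} \<times> UNIV \<times> UNIV)
      (\<lambda>p. (\<lambda>(y,u,v). f y u v) (fst p, cu (fst p) (fst (snd p)), cv (snd (snd p))))"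
    unfolding cv_def
    by (intro continuous_on_compose2[OF f_cont] continuous_intros) (use cu mM_t ab_sub in auto)
  then have cont_G: "continuous_on ({a..b} \<times> UNIV \<times> UNIV) (\<lambda>(t, u, v). G t u v)"
    unfolding G_def using cont_cu by (auto simp: split_beta intro!: continuous_intros)
  have lip_G: "\<bar>G t u v - G t u' v'\<bar> \<le> (L + 2) * (\<bar>u - u'\<bar> + \<bar>v - v'\<bar>)" if t: "t \<in> {a..b}" for t u v u' v'
  proof -
    have "\<bar>f t (cu t u) (cv v) - f t (cu t u') (cv v')\<bar> \<le> L * (\<bar>cu t u - cu t u'\<bar> + \<bar>cv v - cv v'\<bar>)"
      by (intro lip t cu cv)
    also have "\<dots> \<le> L * (\<bar>u - u'\<bar> + \<bar>v - v'\<bar>)"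
      by (intro mult_left_mono add_mono cu_lip cv L)
    finally have f: "\<bar>f t (cu t u) (cv v) - f t (cu t u') (cv v')\<bar> \<le> L * (\<bar>u - u'\<bar> + \<bar>v - v'\<bar>)" .
    have "\<bar>max (- 1) (min 1 x) - max (- 1) (min 1 y)\<bar> \<le> \<bar>x - y\<bar>" for x y :: real by auto
    note this[of "u - cu t u" "u' - cu t u'"]
    also have "(u - cu t u) - (u' - cu t u') = (u - u') - (cu t u - cu t u')" by simp
    also have "\<bar>\<dots>\<bar> \<le> \<bar>u - u'\<bar> + \<bar>u - u'\<bar>"
      by (rule order_trans[OF abs_triangle_ineq4 add_left_mono[OF cu_lip]])
    also have "\<dots> = 2 * \<bar>u - u'\<bar>" by simp
    finally have p: "\<bar>max (- 1) (min 1 (u - cu t u)) - max (- 1) (min 1 (u' - cu t u'))\<bar> \<le> 2 * \<bar>u - u'\<bar>" .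
    have "\<bar>G t u v - G t u' v'\<bar> \<le> L * (\<bar>u - u'\<bar> + \<bar>v - v'\<bar>) + 2 * \<bar>u - u'\<bar>"
      unfolding G_def add_diff_add by (rule order_trans[OF abs_triangle_ineq add_mono[OF f p]])
    then show ?thesis by (rule order_trans) (simp add: distrib_right)
  qed
  obtain B where B: "\<And>t u v. t \<in> {a..b} \<Longrightarrow> \<bar>G t u v\<bar> \<le> B"
  proof -
    have "continuous_on ({a..b} \<times> {m..M} \<times> {- C..C}) (\<lambda>(y,u,v). f y u v)"
      by (rule continuous_on_subset[OF f_cont]) (use ab_sub mM_t in auto)
    then have "bounded ((\<lambda>(y,u,v). f y u v) ` ({a..b} \<times> {m..M} \<times> {- C..C}))"
      by (intro compact_imp_bounded compact_continuous_image compact_Times compact_Icc)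
    then obtain K where K: "\<And>p. p \<in> {a..b} \<times> {m..M} \<times> {- C..C} \<Longrightarrow> norm ((\<lambda>(y,u,v). f y u v) p) \<le> K"
      unfolding bounded_iff by auto
    have "\<bar>G t u v\<bar> \<le> K + 1" if t: "t \<in> {a..b}" for t u v
    proof -
      have "\<bar>f t (cu t u) (cv v)\<bar> \<le> K"
        using K[of "(t, cu t u, cv v)"] t cu[OF t] cv(1)[of v] by (auto simp: abs_le_iff)
      then show ?thesis unfolding G_def by (auto simp: max_def min_def)
    qed
    then show ?thesis by (rule that)
  qed
  obtain u v where sol: "solves_on G a b u v" and bc: "u a = \<alpha> a" "u b = \<alpha> b"
    by (rule dirichlet_problem_bounded_lipschitz[OF ab cont_G _ lip_G B]) (use L in auto)
  have cont_u: "continuous_on {a..b} u" by (rule solves_on_continuous[OF sol])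
  have lower: "\<alpha> t \<le> u t" if t: "t \<in> {a..b}" for t
  proof (rule sub_comparison[OF less_imp_le[OF ab] cont(1) cont_u _ _ solves_onD_at[OF sol] _ t])
    fix t assume t: "a < t" "t < b" and lt: "u t < \<alpha> t"
    then have tab: "t \<in> {a..b}" and tE: "t \<in> E1" using ab_sub by auto
    have cut: "cu t (u t) = \<alpha> t" using lt \<alpha>\<beta>[OF tab] by (auto simp: cu_def)
    \<comment> \<open>Here \<open>cu t (u t) = \<alpha> t\<close>, and equal slopes give
      \<open>cv (v t) = deriv \<alpha> t\<close>; hence \<open>G\<close> is
      \<open>f t (\<alpha> t) (deriv \<alpha> t)\<close> plus a strictly negative penalty.\<close>
    have smooth: "\<exists>e>0. \<exists>\<alpha>' d. (\<forall>x\<in>ball t e. (\<alpha> has_real_derivative \<alpha>' x) (at x)) \<and>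
        (\<alpha>' has_real_derivative d) (at t) \<and> (\<alpha>' t = v t \<longrightarrow> G t (u t) (v t) < d)"
      if e: "e > 0" "C2_on (ball t e) \<alpha>" "deriv (deriv \<alpha>) t \<ge> f t (\<alpha> t) (deriv \<alpha> t)" for e
    proof (intro exI conjI ballI impI)
      show "e > 0" by fact
      show "(\<alpha> has_real_derivative deriv \<alpha> x) (at x)" if "x \<in> ball t e" for x
        using C2_onD(1)[OF e(2) open_ball that] .
      have td: "t \<in> ball t e" using e by simp
      show "(deriv \<alpha> has_real_derivative deriv (deriv \<alpha>) t) (at t)"
        using C2_onD(2)[OF e(2) open_ball td] .
      have "\<alpha> differentiable (at t)"
        using C2_onD(1)[OF e(2) open_ball td] real_differentiable_def by blast
      assume "deriv \<alpha> t = v t"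
      moreover from B1[OF tab \<open>\<alpha> differentiable (at t)\<close>] have "\<bar>deriv \<alpha> t\<bar> \<le> C" using C by simp
      ultimately have "G t (u t) (v t) < f t (\<alpha> t) (deriv \<alpha> t)"
        using lt cv_id by (simp add: G_def cut)
      then show "G t (u t) (v t) < deriv (deriv \<alpha>) t" using e(3) by simp
    qed
    show "(\<exists>e>0. \<exists>\<alpha>' d. (\<forall>x\<in>ball t e. (\<alpha> has_real_derivative \<alpha>' x) (at x)) \<and>
        (\<alpha>' has_real_derivative d) (at t) \<and> (\<alpha>' t = v t \<longrightarrow> G t (u t) (v t) < d)) \<or>
      (\<exists>dl dr. (\<alpha> has_real_derivative dl) (at_left t) \<and> (\<alpha> has_real_derivative dr) (at_right t) \<and> dl < dr)"
      using sub[unfolded subsolution_def, THEN conjunct2, THEN conjunct2, rule_format, OF tE] smooth by blast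
  qed (use bc in auto)
  \<comment> \<open>The upper bound follows from the same comparison lemma after reflection, which
    turns the supersolution kinks into subsolution kinks.\<close>
  have "- \<beta> t \<le> - u t" if t: "t \<in> {a..b}" for t
  proof (rule sub_comparison[OF less_imp_le[OF ab] continuous_on_minus[OF cont(2)] continuous_on_minus[OF cont_u]
        _ _ DERIV_minus[OF solves_onD_at(1)[OF sol]] DERIV_minus[OF solves_onD_at(2)[OF sol]] _ t])
    fix t assume t: "a < t" "t < b" and lt: "- u t < - \<beta> t"
    then have tab: "t \<in> {a..b}" and tE: "t \<in> E1" using ab_sub by auto
    have cut: "cu t (u t) = \<beta> t" using lt \<alpha>\<beta>[OF tab] by (auto simp: cu_def)
    have smooth: "\<exists>e>0. \<exists>\<alpha>' d. (\<forall>x\<in>ball t e. ((\<lambda>x. - \<beta> x) has_real_derivative \<alpha>' x) (at x)) \<and>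
        (\<alpha>' has_real_derivative d) (at t) \<and> (\<alpha>' t = - v t \<longrightarrow> - G t (u t) (v t) < d)"
      if e: "e > 0" "C2_on (ball t e) \<beta>" "deriv (deriv \<beta>) t \<le> f t (\<beta> t) (deriv \<beta> t)" for e
    proof (intro exI conjI ballI impI)
      show "e > 0" by fact
      show "((\<lambda>x. - \<beta> x) has_real_derivative - deriv \<beta> x) (at x)" if "x \<in> ball t e" for x
        using DERIV_minus[OF C2_onD(1)[OF e(2) open_ball that]] .
      have td: "t \<in> ball t e" using e by simp
      show "((\<lambda>x. - deriv \<beta> x) has_real_derivative - deriv (deriv \<beta>) t) (at t)"
        using DERIV_minus[OF C2_onD(2)[OF e(2) open_ball td]] .
      have "\<beta> differentiable (at t)"
        using C2_onD(1)[OF e(2) open_ball td] real_differentiable_def by blast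
      assume "- deriv \<beta> t = - v t"
      moreover from B2[OF tab \<open>\<beta> differentiable (at t)\<close>] have "\<bar>deriv \<beta> t\<bar> \<le> C" using C by simp
      ultimately have "G t (u t) (v t) > f t (\<beta> t) (deriv \<beta> t)"
        using lt cv_id by (simp add: G_def cut)
      then show "- G t (u t) (v t) < - deriv (deriv \<beta>) t" using e(3) by simp
    qed
    have kink: "\<exists>dl dr. ((\<lambda>x. - \<beta> x) has_real_derivative dl) (at_left t) \<and>
        ((\<lambda>x. - \<beta> x) has_real_derivative dr) (at_right t) \<and> dl < dr"
      if "(\<beta> has_real_derivative dl) (at_left t)" "(\<beta> has_real_derivative dr) (at_right t)" "dl > dr" for dl dr
      using DERIV_minus[OF that(1)] DERIV_minus[OF that(2)] that(3)
      by (intro exI[of _ "- dl"] exI[of _ "- dr"]) auto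
    show "(\<exists>e>0. \<exists>\<alpha>' d. (\<forall>x\<in>ball t e. ((\<lambda>x. - \<beta> x) has_real_derivative \<alpha>' x) (at x)) \<and>
        (\<alpha>' has_real_derivative d) (at t) \<and> (\<alpha>' t = - v t \<longrightarrow> - G t (u t) (v t) < d)) \<or>
      (\<exists>dl dr. ((\<lambda>x. - \<beta> x) has_real_derivative dl) (at_left t) \<and>
        ((\<lambda>x. - \<beta> x) has_real_derivative dr) (at_right t) \<and> dl < dr)"
      using super[unfolded supersolution_def, THEN conjunct2, THEN conjunct2, rule_format, OF tE] smooth kink by blast
  qed (use bc \<alpha>\<beta> ab in auto)
  then have upper: "u t \<le> \<beta> t" if "t \<in> {a..b}" for t using that by auto
  \<comment> \<open>Inside the band the penalty vanishes and \<open>cu\<close> is the identity; only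
    the truncation of the slope is left.\<close>
  have G_eq: "G t (u t) (v t) = f t (u t) (cv (v t))" if "t \<in> {a..b}" for t
    using lower[OF that] upper[OF that] by (simp add: G_def cu_def)
  have vN: "\<bar>v t\<bar> \<le> N" if "t \<in> {a..b}" for t
  proof (rule apriori[rule_format, OF sol _ _ that])
    show "u t \<in> {m..M}" if "t \<in> {a..b}" for t
      using lower[OF that] upper[OF that] mM(3,4)[OF that] by auto
    show "\<exists>w. \<bar>w\<bar> \<le> \<bar>v t\<bar> \<and> G t (u t) (v t) = f t (u t) w" if "t \<in> {a..b}" for t
      using G_eq[OF that] cv(3) by blast
  qed
  have "solves_on f a b u v"
  proof (rule solves_on_cong[OF sol])
    fix t assume t: "t \<in> {a..b}"
    have "cv (v t) = v t" using vN[OF t] C by (intro cv_id) simp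
    then show "G t (u t) (v t) = f t (u t) (v t)" using G_eq[OF t] by simp
  qed
  then show ?thesis using that lower upper by blast
qed

section \<open>Compact exhaustion and passage to a global solution\<close>

lemma is_interval_Icc_subset:
  fixes S :: "real set"
  assumes "is_interval S" "x \<in> S" "y \<in> S"
  shows "{x..y} \<subseteq> S"
  using mem_is_interval_1_I[OF assms] by (meson atLeastAtMost_iff subsetI)

text \<open>The minimum of \<open>\<alpha>\<close> and the maximum of \<open>\<beta>\<close> are
  attained values in the interval \<open>E2\<close>. The box must lie in \<open>E2\<close>, and not
  just in \<open>E2t\<close>, because \<open>f\<close> is locally Lipschitz only there.\<close>

lemma continuous_range_box:
  fixes \<alpha> \<beta> :: "real \<Rightarrow> real"
  assumes E2: "is_interval E2"
    and \<alpha>: "continuous_on {a..b} \<alpha>" "\<alpha> ` {a..b} \<subseteq> E2"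
    and \<beta>: "continuous_on {a..b} \<beta>" "\<beta> ` {a..b} \<subseteq> E2"
    and le: "\<And>t. t \<in> {a..b} \<Longrightarrow> \<alpha> t \<le> \<beta> t" and ab: "a \<le> b"
  obtains m M where "m \<le> M" "{m..M} \<subseteq> E2"
    "\<And>t. t \<in> {a..b} \<Longrightarrow> m \<le> \<alpha> t" "\<And>t. t \<in> {a..b} \<Longrightarrow> \<beta> t \<le> M"
proof -
  obtain s where s: "s \<in> {a..b}" "\<And>t. t \<in> {a..b} \<Longrightarrow> \<alpha> s \<le> \<alpha> t"
    using continuous_attains_inf[OF compact_Icc _ \<alpha>(1)] ab by auto
  obtain r where r: "r \<in> {a..b}" "\<And>t. t \<in> {a..b} \<Longrightarrow> \<beta> t \<le> \<beta> r"
    using continuous_attains_sup[OF compact_Icc _ \<beta>(1)] ab by auto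
  show ?thesis
  proof (rule that[of "\<alpha> s" "\<beta> r"])
    show "\<alpha> s \<le> \<beta> r" using s(2)[OF r(1)] le[OF r(1)] by simp
    have "\<alpha> s \<in> E2" "\<beta> r \<in> E2" using \<alpha>(2) \<beta>(2) s(1) r(1) by auto
    then show "{\<alpha> s..\<beta> r} \<subseteq> E2" by (rule is_interval_Icc_subset[OF E2])
  qed (use s r in auto)
qed

text \<open>The endpoints are the infima and suprema of a compact exhaustion of \<open>E\<close>, so
  bounded and unbounded intervals are treated alike.\<close>

lemma open_interval_exhaustion:
  fixes E :: "real set"
  assumes E: "open E" "is_interval E" and pq: "{p..q} \<subseteq> E" "p \<le> q"
  shows "\<exists>a b :: nat \<Rightarrow> real. (\<forall>n. {a n..b n} \<subseteq> E \<and> a n \<le> p \<and> q \<le> b n) \<and>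
    (\<forall>x y. x \<le> y \<longrightarrow> {x..y} \<subseteq> E \<longrightarrow> (\<exists>N. \<forall>n\<ge>N. a n \<le> x \<and> y \<le> b n))"
proof -
  obtain C where C: "\<And>n::nat. compact (C n)" "\<And>n. C n \<subseteq> E"
    "\<And>K. compact K \<Longrightarrow> K \<subseteq> E \<Longrightarrow> \<exists>N. \<forall>n\<ge>N. K \<subseteq> C n"
    using open_Union_compact_subsets[OF E(1)] by metis
  \<comment> \<open>Adding \<open>{p..q}\<close> makes every set nonempty and guarantees a common
    core from the first index on.\<close>
  define D where "D n = C n \<union> {p..q}" for n
  have D: "compact (D n)" "D n \<subseteq> E" "D n \<noteq> {}" for n using C pq by (auto simp: D_def)
  have bdd: "bdd_below (D n)" "bdd_above (D n)" for n
    using compact_imp_bounded[OF D(1)] by (auto intro: bounded_imp_bdd_below bounded_imp_bdd_above)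
  have mem: "Inf (D n) \<in> D n" "Sup (D n) \<in> D n" for n
    using closed_contains_Inf[OF D(3) bdd(1)] closed_contains_Sup[OF D(3) bdd(2)]
      compact_imp_closed[OF D(1)] by auto
  show ?thesis
  proof (rule exI[of _ "\<lambda>n. Inf (D n)"], rule exI[of _ "\<lambda>n. Sup (D n)"], intro conjI allI impI)
    show "{Inf (D n)..Sup (D n)} \<subseteq> E" for n
      using mem[of n] D(2)[of n] by (intro is_interval_Icc_subset[OF E(2)]) auto
    show "Inf (D n) \<le> p" "q \<le> Sup (D n)" for n
      using cInf_lower[OF _ bdd(1), of p n] cSup_upper[OF _ bdd(2), of q n] pq by (auto simp: D_def)
    fix x y :: real assume xy: "x \<le> y" "{x..y} \<subseteq> E"
    then obtain N where N: "\<And>n. n \<ge> N \<Longrightarrow> {x..y} \<subseteq> C n" using C(3) compact_Icc by metis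
    have "Inf (D n) \<le> x \<and> y \<le> Sup (D n)" if "n \<ge> N" for n
      using cInf_lower[OF _ bdd(1), of x n] cSup_upper[OF _ bdd(2), of y n] N[OF that] xy
      by (auto simp: D_def)
    then show "\<exists>N. \<forall>n\<ge>N. Inf (D n) \<le> x \<and> y \<le> Sup (D n)" by blast
  qed
qed

theorem theorem6p10:
  fixes E1 E2 E2t :: "real set" and f :: "real \<Rightarrow> real \<Rightarrow> real \<Rightarrow> real"
    and \<alpha> \<beta> :: "real \<Rightarrow> real"
  assumes E1: "open E1" "is_interval E1"
    and E2: "open E2" "is_interval E2"
    and E2t: "E2 \<subseteq> E2t" "E2t \<subseteq> closure E2"
    and f_cont: "continuous_on (E1 \<times> E2t \<times> UNIV) (\<lambda>(y,u,v). f y u v)"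
    and f_lip: "loc_lipschitz_on (E1 \<times> E2 \<times> UNIV) f"
    and f_nagumo: "nagumo E1 E2t f"
    and \<alpha>_C: "continuous_on E1 \<alpha>" "\<alpha> ` E1 \<subseteq> E2"
    and \<beta>_C: "continuous_on E1 \<beta>" "\<beta> ` E1 \<subseteq> E2"
    and \<alpha>_X: "classX E1 E2t \<alpha>" and \<beta>_X: "classX E1 E2t \<beta>"
    and le: "\<forall>y\<in>E1. \<alpha> y \<le> \<beta> y"
    and sub: "subsolution E1 E2t f \<alpha>" and super: "supersolution E1 E2t f \<beta>"
  shows "\<exists>u. global_solution E1 E2t f u \<and> (\<forall>y\<in>E1. \<alpha> y \<le> u y \<and> u y \<le> \<beta> y)"
proof (cases "E1 = {}")
  case True
  then show ?thesis by (auto simp: global_solution_def C2_on_def)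
next
  case False
  then obtain c where c: "c \<in> E1" by blast
  obtain \<rho> where \<rho>: "\<rho> > 0" "cball c \<rho> \<subseteq> E1" using open_contains_cball_eq[OF E1(1)] c by blast
  define p0 q0 where "p0 = c - \<rho>" and "q0 = c + \<rho>"
  have pq0: "p0 < q0" "{p0..q0} \<subseteq> E1" "c \<in> {p0..q0}"
    using \<rho> by (auto simp: p0_def q0_def cball_eq_atLeastAtMost)
  have box: "\<exists>m M. m \<le> M \<and> {m..M} \<subseteq> E2 \<and> (\<forall>t\<in>{p..q}. m \<le> \<alpha> t \<and> \<beta> t \<le> M)"
    if pq: "p < q" "{p..q} \<subseteq> E1" for p q
  proof -
    have "continuous_on {p..q} \<alpha>" "continuous_on {p..q} \<beta>" "\<alpha> ` {p..q} \<subseteq> E2" "\<beta> ` {p..q} \<subseteq> E2"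
      "\<And>t. t \<in> {p..q} \<Longrightarrow> \<alpha> t \<le> \<beta> t"
      using \<alpha>_C \<beta>_C le pq(2) continuous_on_subset by blast+
    from continuous_range_box[OF E2(2) this(1,3,2,4,5) less_imp_le[OF pq(1)]] show ?thesis by metis
  qed
  obtain a b :: "nat \<Rightarrow> real" where ab': "\<forall>n. {a n..b n} \<subseteq> E1 \<and> a n \<le> p0 \<and> q0 \<le> b n"
    and exh: "\<forall>x y. x \<le> y \<longrightarrow> {x..y} \<subseteq> E1 \<longrightarrow> (\<exists>N. \<forall>n\<ge>N. a n \<le> x \<and> y \<le> b n)"
    using open_interval_exhaustion[OF E1 pq0(2) less_imp_le[OF pq0(1)]] by (elim exE conjE) (rule that)
  have ab: "{a n..b n} \<subseteq> E1" "a n \<le> p0" "q0 \<le> b n" for n using ab' by blast+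
  have "\<exists>u v. solves_on f (a n) (b n) u v \<and> (\<forall>t\<in>{a n..b n}. \<alpha> t \<le> u t \<and> u t \<le> \<beta> t)" for n
  proof -
    have lt: "a n < b n" using ab(2,3)[of n] pq0(1) by linarith
    obtain m M where mM: "m \<le> M" "{m..M} \<subseteq> E2" "\<And>t. t \<in> {a n..b n} \<Longrightarrow> m \<le> \<alpha> t"
        "\<And>t. t \<in> {a n..b n} \<Longrightarrow> \<beta> t \<le> M"
      using box[OF lt ab(1)] by blast
    obtain u v where "solves_on f (a n) (b n) u v" "\<And>t. t \<in> {a n..b n} \<Longrightarrow> \<alpha> t \<le> u t \<and> u t \<le> \<beta> t"
      by (rule ordered_dirichlet_solution[OF E2t(1) f_cont f_lip f_nagumo \<alpha>_C \<beta>_C \<alpha>_X \<beta>_X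
            le sub super lt ab(1) mM], assumption+) (rule that, blast+)
    then show ?thesis by blast
  qed
  then obtain u v where sol: "\<And>n. solves_on f (a n) (b n) (u n) (v n)"
    and u: "\<And>n t. t \<in> {a n..b n} \<Longrightarrow> \<alpha> t \<le> u n t \<and> u n t \<le> \<beta> t"
    by metis
  \<comment> \<open>Restricted to \<open>{p..q}\<close>, all these solutions satisfy one equation
    within one box, so the a priori bound is uniform in \<open>n\<close>.\<close>
  have vbound: "\<exists>N. \<forall>n. a n \<le> p \<longrightarrow> q \<le> b n \<longrightarrow> (\<forall>t\<in>{p..q}. \<bar>v n t\<bar> \<le> N)"
    if pq: "p < q" "{p..q} \<subseteq> E1" for p q
  proof -
    obtain m M where mM: "m \<le> M" "{m..M} \<subseteq> E2" "\<And>t. t \<in> {p..q} \<Longrightarrow> m \<le> \<alpha> t \<and> \<beta> t \<le> M"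
      using box[OF pq] by blast
    have sub_t: "{m..M} \<subseteq> E2t" using mM(2) E2t(1) by blast
    obtain N where "0 < N" and N: "\<forall>G u v. solves_on G p q u v \<longrightarrow> (\<forall>t\<in>{p..q}. u t \<in> {m..M}) \<longrightarrow>
      (\<forall>t\<in>{p..q}. \<exists>w. \<bar>w\<bar> \<le> \<bar>v t\<bar> \<and> G t (u t) (v t) = f t (u t) w) \<longrightarrow>
      (\<forall>t\<in>{p..q}. \<bar>v t\<bar> \<le> N)"
      using nagumo_apriori_bound[OF f_cont f_nagumo pq(1) mM(1) pq(2) sub_t] by (elim exE conjE) (rule that)
    show ?thesis
    proof (intro exI allI impI ballI)
      fix n t assume n: "a n \<le> p" "q \<le> b n" and t: "t \<in> {p..q}"
      show "\<bar>v n t\<bar> \<le> N"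
      proof (rule N[rule_format, OF solves_on_subset[OF sol n] _ _ t])
        show "u n t \<in> {m..M}" if "t \<in> {p..q}" for t
          using u[of t n] mM(3)[OF that] n that by auto
      qed auto
    qed
  qed
  \<comment> \<open>The states at the single point \<open>c\<close> lie in a compact rectangle; one
    subsequence chosen there serves every compact interval containing \<open>c\<close>.\<close>
  obtain r l where r: "strict_mono r" and l: "(\<lambda>n. (u (r n) c, v (r n) c)) \<longlonglongrightarrow> l"
  proof -
    obtain N where N: "\<And>n. \<bar>v n c\<bar> \<le> N" using vbound[OF pq0(1,2)] ab(2,3) pq0(3) by blast
    have mem: "\<forall>n. (u n c, v n c) \<in> {\<alpha> c..\<beta> c} \<times> {- N..N}"
    proof
      show "(u n c, v n c) \<in> {\<alpha> c..\<beta> c} \<times> {- N..N}" for n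
        using u[of c n] N[of n] ab(2,3)[of n] pq0(3) by (auto simp: abs_le_iff)
    qed
    have "seq_compact ({\<alpha> c..\<beta> c} \<times> {- N..N})"
      by (intro compact_imp_seq_compact compact_Times compact_Icc)
    from this[unfolded seq_compact_def, THEN spec, THEN mp, OF mem] show ?thesis
      using that by (auto simp only: comp_def)
  qed
  have conv: "convergent (\<lambda>n. u (r n) c)" "convergent (\<lambda>n. v (r n) c)"
    using tendsto_fst[OF l] tendsto_snd[OF l] by (auto simp: convergent_def)
  \<comment> \<open>Pointwise limits give functions that do not depend on an interval;
    \<open>local\<close> identifies them on each \<open>{p..q}\<close> with the limits found
    there.\<close>
  define U V where "U t = lim (\<lambda>n. u (r n) t)" and "V t = lim (\<lambda>n. v (r n) t)" for t
  have local: "solves_on f p q U V \<and> (\<forall>t\<in>{p..q}. \<alpha> t \<le> U t \<and> U t \<le> \<beta> t)"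
    if pq: "p < q" "{p..q} \<subseteq> E1" "c \<in> {p..q}" for p q
  proof -
    obtain m M where mM: "m \<le> M" "{m..M} \<subseteq> E2" "\<And>t. t \<in> {p..q} \<Longrightarrow> m \<le> \<alpha> t \<and> \<beta> t \<le> M"
      using box[OF pq(1,2)] by blast
    obtain N where N: "\<And>n t. a n \<le> p \<Longrightarrow> q \<le> b n \<Longrightarrow> t \<in> {p..q} \<Longrightarrow> \<bar>v n t\<bar> \<le> N"
      using vbound[OF pq(1,2)] by blast
    obtain k where k: "\<And>n. n \<ge> k \<Longrightarrow> a n \<le> p \<and> q \<le> b n"
      using exh[rule_format, OF less_imp_le[OF pq(1)] pq(2)] by blast
    \<comment> \<open>The first \<open>k\<close> terms may not solve the equation on all of
      \<open>{p..q}\<close>. The shift discards them, since \<open>r (n + k) \<ge> n + k\<close> by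
      strict monotonicity.\<close>
    have rk: "a (r (n + k)) \<le> p" "q \<le> b (r (n + k))" for n
      using k[of "r (n + k)"] seq_suble[OF r, of "n + k"] by auto
    have "continuous_on (E1 \<times> E2 \<times> UNIV) (\<lambda>(y,u,v). f y u v)"
      by (rule continuous_on_subset[OF f_cont]) (use E2t(1) in auto)
    from loc_lipschitz_on_box[OF this f_lip pq(2) mM(2), of N] obtain L where L: "L \<ge> 0" and lip:
      "\<And>t u v u' v'. t \<in> {p..q} \<Longrightarrow> u \<in> {m..M} \<Longrightarrow> u' \<in> {m..M} \<Longrightarrow> \<bar>v\<bar> \<le> N \<Longrightarrow> \<bar>v'\<bar> \<le> N \<Longrightarrow>
        \<bar>f t u v - f t u' v'\<bar> \<le> L * (\<bar>u - u'\<bar> + \<bar>v - v'\<bar>)"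
      by blast
    have uk: "\<alpha> t \<le> u (r (n + k)) t \<and> u (r (n + k)) t \<le> \<beta> t" if "t \<in> {p..q}" for n t
      using u[of t "r (n + k)"] rk[of n] that by auto
    have bd: "u (r (n + k)) t \<in> {m..M}" "\<bar>v (r (n + k)) t\<bar> \<le> N" if "t \<in> {p..q}" for n t
      using uk[OF that, of n] mM(3)[OF that] N[OF rk that] by auto
    have conv_k: "convergent (\<lambda>n. u (r (n + k)) c)" "convergent (\<lambda>n. v (r (n + k)) c)"
      using conv convergent_ignore_initial_segment[of "\<lambda>n. u (r n) c" k]
        convergent_ignore_initial_segment[of "\<lambda>n. v (r n) c" k] by blast+
    obtain U' V' where sol': "solves_on f p q U' V'"
      and U': "\<And>t. t \<in> {p..q} \<Longrightarrow> (\<lambda>n. u (r (n + k)) t) \<longlonglongrightarrow> U' t"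
      and V': "\<And>t. t \<in> {p..q} \<Longrightarrow> (\<lambda>n. v (r (n + k)) t) \<longlonglongrightarrow> V' t"
      by (rule solves_on_limit[where u = "\<lambda>n. u (r (n + k))" and v = "\<lambda>n. v (r (n + k))",
            OF solves_on_subset[OF sol rk] pq(3) bd L lip conv_k], assumption+) (rule that, blast+)
    have eq: "U t = U' t" "V t = V' t" if "t \<in> {p..q}" for t
      unfolding U_def V_def
      using LIMSEQ_offset[OF U'[OF that]] LIMSEQ_offset[OF V'[OF that]] by (auto intro: limI)
    have "solves_on f p q U V"
      unfolding solves_on_def
    proof (intro ballI conjI)
      fix t assume t: "t \<in> {p..q}"
      show "(U has_real_derivative V t) (at t within {p..q})"
        unfolding eq(2)[OF t]
        by (rule has_field_derivative_transform_within[OF solves_onD(1)[OF sol' t] zero_less_one t]) (simp add: eq)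
      show "(V has_real_derivative f t (U t) (V t)) (at t within {p..q})"
        unfolding eq[OF t]
        by (rule has_field_derivative_transform_within[OF solves_onD(2)[OF sol' t] zero_less_one t]) (simp add: eq)
    qed
    moreover have "\<alpha> t \<le> U t \<and> U t \<le> \<beta> t" if "t \<in> {p..q}" for t
      unfolding eq(1)[OF that]
      using LIMSEQ_le_const[OF U'[OF that], of "\<alpha> t"] LIMSEQ_le_const2[OF U'[OF that], of "\<beta> t"] uk[OF that] by auto
    ultimately show ?thesis by blast
  qed
  have at: "(U has_real_derivative V t) (at t) \<and> (V has_real_derivative f t (U t) (V t)) (at t) \<and>
      \<alpha> t \<le> U t \<and> U t \<le> \<beta> t" if t: "t \<in> E1" for t
  proof -
    obtain d where d: "d > 0" "cball t d \<subseteq> E1" using open_contains_cball_eq[OF E1(1)] t by blast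
    \<comment> \<open>The interval is stretched to contain \<open>c\<close>, where convergence is
      known, and to have \<open>t\<close> in its interior, where derivatives are two-sided.\<close>
    define p q where "p = min c (t - d)" and "q = max c (t + d)"
    have "t - d \<in> E1" "t + d \<in> E1" using d by (auto simp: cball_eq_atLeastAtMost)
    then have "p \<in> E1" "q \<in> E1" using c by (auto simp: p_def q_def min_def max_def)
    then have sub: "{p..q} \<subseteq> E1" by (rule is_interval_Icc_subset[OF E1(2)])
    have tpq: "p < t" "t < q" "c \<in> {p..q}" using d(1) by (auto simp: p_def q_def)
    then have "p < q" by simp
    from local[OF this sub tpq(3)] tpq show ?thesis using solves_onD_at[of f p q U V t] by auto
  qed
  have dU: "deriv U t = V t" if "t \<in> E1" for t using at[OF that] DERIV_imp_deriv by blast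
  have ddU: "deriv (deriv U) t = f t (U t) (deriv U t)" if t: "t \<in> E1" for t
  proof -
    have "(deriv U has_real_derivative f t (U t) (V t)) (at t)"
      by (rule has_field_derivative_transform_within_open[OF _ E1(1) t, of V]) (use at[OF t] dU in auto)
    then show ?thesis using DERIV_imp_deriv dU[OF t] by metis
  qed
  have range: "U t \<in> E2" if t: "t \<in> E1" for t
  proof -
    have "{\<alpha> t..\<beta> t} \<subseteq> E2" using \<alpha>_C(2) \<beta>_C(2) t by (intro is_interval_Icc_subset[OF E2(2)]) auto
    then show ?thesis using at[OF t] by auto
  qed
  have contUV: "continuous_on E1 U" "continuous_on E1 V"
    using at by (meson DERIV_isCont continuous_at_imp_continuous_on)+
  have "continuous_on E1 (\<lambda>t. (\<lambda>(y,u,v). f y u v) (t, U t, V t))"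
    by (rule continuous_on_compose2[OF f_cont])
       (use range E2t(1) contUV in \<open>auto intro!: continuous_intros\<close>)
  then have "C2_on E1 U"
    unfolding C2_on_def using at by (intro exI[of _ V] exI[of _ "\<lambda>t. f t (U t) (V t)"]) auto
  then have "global_solution E1 E2t f U"
    unfolding global_solution_def using range E2t(1) ddU by auto
  then show ?thesis using at by blast
qed

end
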